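(* The class of strongly base reorderable matroids is complete, i.e. it is closed under taking minors, duals, direct sums, truncations, and induction by directed graphs.
   Context: All matroids are finite. A matroid is strongly base reorderable (SBRO) if for any pair $A,B$ of bases there exist bases $A',B'$ and a bijection $\varphi\colon A'\setminus B'\to B'\setminus A'$ such that $A'\cap B'=A\cap B$, $A'\cup B'=A\cup B$, and $(A'\setminus X)\cup\varphi(X)$ is a basis for every $X\subseteq A'\setminus B'$. Following Ingleton, a class of matroids is complete if it is closed under minors, duals, direct sums, truncations (for a matroid $M$ and integer $k\ge 0$, the $k$-truncation has as independent sets the independent sets of $M$ of size at most $k$), and induction by directed graphs (given a directed graph $D=(V,A)$ and a matroid $N$ on a subset $S\subseteq V$, the induced matroid on $V$ has as independent sets those $X\subseteq V$ for which there exist $|X|$ pairwise vertex-disjoint directed paths starting at the elements of $X$ and ending in an independent set of $N$). *)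

theory Defs
  imports
    "HOL-Library.Disjoint_Sets"
    "Graph_Theory.Pair_Digraph"
    "Graph_Theory.Vertex_Walk"
begin

section \<open>Finite matroids\<close>

record 'a pre_matroid =
  ground :: "'a set"
  indeps :: "'a set set"

locale matroid =
  fixes M :: "'a pre_matroid"
  assumes finite_ground: "finite (ground M)"
    and indeps_subset_ground: "X \<in> indeps M \<Longrightarrow> X \<subseteq> ground M"
    and empty_indep: "{} \<in> indeps M"
    and indep_subset: "\<lbrakk>X \<in> indeps M; Y \<subseteq> X\<rbrakk> \<Longrightarrow> Y \<in> indeps M"
    and augmentation:
      "\<lbrakk>X \<in> indeps M; Y \<in> indeps M; card X < card Y\<rbrakk> \<Longrightarrow> \<exists>y\<in>Y - X. insert y X \<in> indeps M"

definition is_basis :: "'a pre_matroid \<Rightarrow> 'a set \<Rightarrow> bool" where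
  "is_basis M B \<longleftrightarrow> B \<in> indeps M \<and> (\<forall>X\<in>indeps M. B \<subseteq> X \<longrightarrow> X = B)"

definition strongly_base_reorderable :: "'a pre_matroid \<Rightarrow> bool" where
  "strongly_base_reorderable M \<longleftrightarrow>
    (\<forall>A B. is_basis M A \<longrightarrow> is_basis M B \<longrightarrow>
      (\<exists>A' B' \<phi>. is_basis M A' \<and> is_basis M B' \<and>
        bij_betw \<phi> (A' - B') (B' - A') \<and>
        A' \<inter> B' = A \<inter> B \<and> A' \<union> B' = A \<union> B \<and>
        (\<forall>X. X \<subseteq> A' - B' \<longrightarrow> is_basis M ((A' - X) \<union> \<phi> ` X))))"

section \<open>Matroid operations\<close>

definition dual_matroid :: "'a pre_matroid \<Rightarrow> 'a pre_matroid" where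
  "dual_matroid M =
    \<lparr>ground = ground M,
     indeps = {X. \<exists>B. is_basis M B \<and> X \<subseteq> ground M - B}\<rparr>"

definition deletion :: "'a pre_matroid \<Rightarrow> 'a set \<Rightarrow> 'a pre_matroid" where
  "deletion M D =
    \<lparr>ground = ground M - D, indeps = {X \<in> indeps M. X \<inter> D = {}}\<rparr>"

definition contraction :: "'a pre_matroid \<Rightarrow> 'a set \<Rightarrow> 'a pre_matroid" where
  "contraction M C = dual_matroid (deletion (dual_matroid M) C)"

definition is_minor :: "'a pre_matroid \<Rightarrow> 'a pre_matroid \<Rightarrow> bool" where
  "is_minor N M \<longleftrightarrow>
    (\<exists>C D. C \<subseteq> ground M \<and> D \<subseteq> ground M \<and> C \<inter> D = {} \<and>
      N = deletion (contraction M C) D)"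

text \<open>Only meaningful for matroids on disjoint ground sets.\<close>
definition direct_sum :: "'a pre_matroid \<Rightarrow> 'a pre_matroid \<Rightarrow> 'a pre_matroid" where
  "direct_sum M N =
    \<lparr>ground = ground M \<union> ground N,
     indeps = {X \<union> Y | X Y. X \<in> indeps M \<and> Y \<in> indeps N}\<rparr>"

definition truncation :: "nat \<Rightarrow> 'a pre_matroid \<Rightarrow> 'a pre_matroid" where
  "truncation k M =
    \<lparr>ground = ground M, indeps = {X \<in> indeps M. card X \<le> k}\<rparr>"

text \<open>
  Paths are non-empty lists of distinct vertices; a single vertex is a path, so an
  element may be linked to itself. The path \<^term>\<open>P x\<close> is the one that starts at \<^term>\<open>x\<close>.
\<close>
definition linked_to_indep ::
    "'a pair_pre_digraph \<Rightarrow> 'a pre_matroid \<Rightarrow> 'a set \<Rightarrow> bool" where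
  "linked_to_indep D N X \<longleftrightarrow>
    (\<exists>P. (\<forall>x\<in>X. vpath (P x) (with_proj D) \<and> hd (P x) = x) \<and>
      disjoint_family_on (\<lambda>x. set (P x)) X \<and>
      (\<lambda>x. last (P x)) ` X \<in> indeps N)"

definition induced_matroid ::
    "'a pair_pre_digraph \<Rightarrow> 'a pre_matroid \<Rightarrow> 'a pre_matroid" where
  "induced_matroid D N =
    \<lparr>ground = pverts D, indeps = {X. X \<subseteq> pverts D \<and> linked_to_indep D N X}\<rparr>"

section \<open>Complete classes\<close>

text \<open>
  Operations are defined on arbitrary set systems, so membership of their results in
  the class includes the claim that these results are matroids.
\<close>
definition complete_class :: "'a pre_matroid set \<Rightarrow> bool" where
  "complete_class \<C> \<longleftrightarrow>
    (\<forall>M\<in>\<C>. matroid M) \<and>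
    (\<forall>M\<in>\<C>. \<forall>N. is_minor N M \<longrightarrow> N \<in> \<C>) \<and>
    (\<forall>M\<in>\<C>. dual_matroid M \<in> \<C>) \<and>
    (\<forall>M\<in>\<C>. \<forall>N\<in>\<C>. ground M \<inter> ground N = {} \<longrightarrow> direct_sum M N \<in> \<C>) \<and>
    (\<forall>M\<in>\<C>. \<forall>k. truncation k M \<in> \<C>) \<and>
    (\<forall>N\<in>\<C>. \<forall>D. pair_fin_digraph D \<longrightarrow> ground N \<subseteq> pverts D \<longrightarrow> induced_matroid D N \<in> \<C>)"

end

theory Submission
  imports Defs
begin

text \<open>
  A matroid is strongly base reorderable iff for any two bases the symmetric difference can be
  partitioned into pairs such that the intersection together with any transversal of the pairs is
  a basis. In this symmetric form, duals, deletions and direct sums are immediate. Truncations by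
  one and principal extensions rest on one observation: if \<open>I + f\<close> and \<open>J + g\<close> are bases, then
  pairing up the partners of \<open>f\<close> and \<open>g\<close> gives pairs for \<open>I\<close> and \<open>J\<close> all of whose transversals
  become bases after adding \<open>f\<close> or \<open>g\<close>. Induction by a bipartite graph is a sequence of principal
  extensions followed by a deletion, and by the linkage lemma of Ingleton and Piff induction by a
  directed graph is dual to induction by a bipartite graph.
\<close>

subsection \<open>Bases and pairings\<close>

text \<open>What the symmetric form buys is freedom in re-pairing. A basis of a truncation or of a
  principal extension can be completed to a basis of the original matroid in several ways, and two
  such bases may need different completing elements \<open>f\<close> and \<open>g\<close>. No single
  element need complete all transversals, so the pairs have to be rearranged and the completing
  element chosen separately for each transversal. This is also why the rank is lowered by one at a
  time and the vertices are added one at a time. The dual in the treatment of directed graphs turns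
  a global object into local choices: a family of disjoint paths is replaced by a matching in which
  each vertex selects one vertex near it, and this is what a bipartite graph can encode. Since a
  principal extension needs an element outside the ground set, while the vertex set contains the
  ground set, the bipartite construction works on a disjoint sum of the two.\<close>

context matroid
begin

lemma indep_finite: "X \<in> indeps M \<Longrightarrow> finite X"
  using finite_ground indeps_subset_ground finite_subset by blast

lemma basis_card_max:
  assumes "is_basis M B" "X \<in> indeps M"
  shows "card X \<le> card B"
proof (rule ccontr)
  assume "\<not> card X \<le> card B"
  then obtain y where "y \<in> X - B" "insert y B \<in> indeps M"
    using augmentation[of B X] assms unfolding is_basis_def by auto
  then show False
    using assms(1) unfolding is_basis_def by blast
qed

lemma basis_card_eq: "is_basis M A \<Longrightarrow> is_basis M B \<Longrightarrow> card A = card B"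
  using basis_card_max unfolding is_basis_def by (simp add: le_antisym)

text \<open>Once one basis of a derived matroid is known, this replaces maximality arguments by
  independence and a count.\<close>

lemma basis_iff_card:
  assumes "is_basis M B"
  shows "is_basis M X \<longleftrightarrow> X \<in> indeps M \<and> card X = card B"
proof
  assume X: "X \<in> indeps M \<and> card X = card B"
  have "Y = X" if "Y \<in> indeps M" "X \<subseteq> Y" for Y
    using basis_card_max[OF assms that(1)] X that indep_finite card_seteq by metis
  with X show "is_basis M X"
    unfolding is_basis_def by blast
next
  assume "is_basis M X"
  then show "X \<in> indeps M \<and> card X = card B"
    using basis_card_eq[OF _ assms] by (simp add: is_basis_def)
qed

text \<open>Repeated augmentation from \<open>B\<close>. The bound
  \<open>C \<subseteq> I \<union> B\<close> matters later: it keeps the extended basis away from a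
  given set for duals, and lets two bases of a deletion be extended by the same elements.\<close>

lemma indep_extend:
  assumes "is_basis M B" "I \<in> indeps M"
  obtains C where "is_basis M C" "I \<subseteq> C" "C \<subseteq> I \<union> B"
proof -
  have "\<exists>C. is_basis M C \<and> I \<subseteq> C \<and> C \<subseteq> I \<union> B"
    using assms(2)
  proof (induction "card B - card I" arbitrary: I)
    case 0
    then have "is_basis M I"
      using basis_card_max[OF assms(1) 0(2)] basis_iff_card[OF assms(1)] by simp
    then show ?case by blast
  next
    case (Suc n)
    have "card I < card B" "B \<in> indeps M"
      using Suc.hyps(2) assms(1) by (auto simp: is_basis_def)
    then obtain y where y: "y \<in> B - I" "insert y I \<in> indeps M"
      using augmentation Suc.prems by blast
    have "card (insert y I) = Suc (card I)"
      using y Suc.prems indep_finite by auto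
    then have "n = card B - card (insert y I)"
      using Suc.hyps(2) by simp
    from Suc.hyps(1)[OF this y(2)] y show ?case by blast
  qed
  then show ?thesis using that by blast
qed

lemma basis_exists: obtains B where "is_basis M B"
proof -
  have "finite (indeps M)"
    using finite_ground indeps_subset_ground by (auto intro: finite_subset[of _ "Pow (ground M)"])
  then obtain B where "B \<in> indeps M" "\<forall>X\<in>indeps M. B \<subseteq> X \<longrightarrow> X = B"
    using finite_has_maximal2[OF _ empty_indep] by metis
  then show ?thesis using that unfolding is_basis_def by blast
qed

lemma basis_subset_ground: "is_basis M B \<Longrightarrow> B \<subseteq> ground M"
  using indeps_subset_ground unfolding is_basis_def by blast

lemma indep_iff_subset_basis: "X \<in> indeps M \<longleftrightarrow> (\<exists>B. is_basis M B \<and> X \<subseteq> B)"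
proof
  assume "X \<in> indeps M"
  then obtain B where "is_basis M B" "X \<subseteq> B"
    using basis_exists indep_extend by metis
  then show "\<exists>B. is_basis M B \<and> X \<subseteq> B" by blast
qed (use indep_subset in \<open>auto simp: is_basis_def\<close>)

end

lemma is_basis_cong: "indeps M = indeps N \<Longrightarrow> is_basis M = is_basis N"
  unfolding is_basis_def by (rule ext) simp

section \<open>Transversals of pairs\<close>

text \<open>
  Strong base reorderability in symmetric form: \<open>\<sigma>\<close> pairs up the symmetric difference \<open>D\<close>
  of two bases with intersection \<open>C\<close>, and the sets \<open>A'\<close>, \<open>B'\<close> and \<open>(A' - X) \<union> \<phi>(X)\<close>
  of the definition are exactly the sets \<open>C \<union> T\<close> with \<open>T\<close> a transversal of the pairs.
\<close>
definition pairing :: "('a set \<Rightarrow> bool) \<Rightarrow> 'a set \<Rightarrow> 'a set \<Rightarrow> ('a \<Rightarrow> 'a) \<Rightarrow> bool" where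
  "pairing \<B> C D \<sigma> \<longleftrightarrow>
    (\<forall>x\<in>D. \<sigma> x \<in> D \<and> \<sigma> x \<noteq> x \<and> \<sigma> (\<sigma> x) = x) \<and>
    (\<forall>T\<subseteq>D. (\<forall>x\<in>D. x \<in> T \<longleftrightarrow> \<sigma> x \<notin> T) \<longrightarrow> \<B> (C \<union> T))"

lemma pairingI:
  assumes "\<And>x. x \<in> D \<Longrightarrow> \<sigma> x \<in> D \<and> \<sigma> x \<noteq> x \<and> \<sigma> (\<sigma> x) = x"
    and "\<And>T. T \<subseteq> D \<Longrightarrow> (\<And>x. x \<in> D \<Longrightarrow> x \<in> T \<longleftrightarrow> \<sigma> x \<notin> T) \<Longrightarrow> \<B> (C \<union> T)"
  shows "pairing \<B> C D \<sigma>"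
  using assms unfolding pairing_def by blast

lemma pairing_involution:
  assumes "pairing \<B> C D \<sigma>" "x \<in> D"
  shows "\<sigma> x \<in> D" "\<sigma> x \<noteq> x" "\<sigma> (\<sigma> x) = x"
  using assms unfolding pairing_def by auto

lemma pairing_transversal:
  assumes "pairing \<B> C D \<sigma>" "T \<subseteq> D" "\<And>x. x \<in> D \<Longrightarrow> x \<in> T \<longleftrightarrow> \<sigma> x \<notin> T"
  shows "\<B> (C \<union> T)"
  using assms unfolding pairing_def by blast

lemma pairing_mono:
  assumes "pairing \<B> C D \<sigma>" "\<And>X. C \<subseteq> X \<Longrightarrow> X \<subseteq> C \<union> D \<Longrightarrow> \<B> X \<Longrightarrow> \<B>' X"
  shows "pairing \<B>' C D \<sigma>"
proof (rule pairingI)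
  fix T assume T: "T \<subseteq> D" "\<And>x. x \<in> D \<Longrightarrow> x \<in> T \<longleftrightarrow> \<sigma> x \<notin> T"
  show "\<B>' (C \<union> T)"
    using T(1) by (intro assms(2) pairing_transversal[OF assms(1) T]) auto
qed (use pairing_involution[OF assms(1)] in simp)

lemma pairing_if_exchange_bijection:
  assumes bij: "bij_betw \<phi> (A - B) (B - A)"
    and basis: "\<And>X. X \<subseteq> A - B \<Longrightarrow> \<B> ((A - X) \<union> \<phi> ` X)"
  shows "\<exists>\<sigma>. pairing \<B> (A \<inter> B) (sym_diff A B) \<sigma>"
proof -
  define \<psi> where "\<psi> = inv_into (A - B) \<phi>"
  define \<sigma> where "\<sigma> x = (if x \<in> A - B then \<phi> x else \<psi> x)" for x
  have \<phi>: "\<phi> x \<in> B - A" "\<psi> (\<phi> x) = x" if "x \<in> A - B" for x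
    using that bij unfolding \<psi>_def bij_betw_def by auto
  have \<psi>: "\<psi> x \<in> A - B" "\<phi> (\<psi> x) = x" if "x \<in> B - A" for x
    using that bij unfolding \<psi>_def bij_betw_def by (auto intro: f_inv_into_f inv_into_into)
      (metis DiffE DiffI inv_into_into)+
  have "pairing \<B> (A \<inter> B) (sym_diff A B) \<sigma>"
  proof (rule pairingI)
    fix x assume "x \<in> sym_diff A B"
    then consider "x \<in> A - B" | "x \<in> B - A" by blast
    then show "\<sigma> x \<in> sym_diff A B \<and> \<sigma> x \<noteq> x \<and> \<sigma> (\<sigma> x) = x"
    proof cases
      case 1
      with \<phi>[OF 1] show ?thesis unfolding \<sigma>_def by auto
    next
      case 2
      with \<psi>[OF 2] show ?thesis unfolding \<sigma>_def by auto
    qed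
  next
    fix T assume T: "T \<subseteq> sym_diff A B" "\<And>x. x \<in> sym_diff A B \<Longrightarrow> x \<in> T \<longleftrightarrow> \<sigma> x \<notin> T"
    \<comment> \<open>The elements of \<open>A - B\<close> that \<open>T\<close> omits. Their
      partners are exactly what \<open>T\<close> takes from \<open>B - A\<close>, so exchanging
      \<open>X\<close> turns \<open>A\<close> into \<open>A \<inter> B \<union> T\<close>.\<close>
    define X where "X = A - B - T"
    have 1: "x \<in> T \<longleftrightarrow> \<phi> x \<notin> T" if "x \<in> A - B" for x
      using T(2)[of x] that unfolding \<sigma>_def by auto
    have "\<phi> ` X = T - A"
    proof
      show "\<phi> ` X \<subseteq> T - A" unfolding X_def using 1 \<phi> by blast
      show "T - A \<subseteq> \<phi> ` X"
      proof
        fix y assume y: "y \<in> T - A"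
        then have "y \<in> B - A" using T by blast
        with \<psi>[of y] 1[of "\<psi> y"] y have "\<psi> y \<in> X" "\<phi> (\<psi> y) = y"
          unfolding X_def by auto
        then show "y \<in> \<phi> ` X" by force
      qed
    qed
    then have "(A - X) \<union> \<phi> ` X = A \<inter> B \<union> T"
      using T unfolding X_def by blast
    then show "\<B> (A \<inter> B \<union> T)"
      using basis[of X] unfolding X_def by auto
  qed
  then show ?thesis by blast
qed

text \<open>Any transversal \<open>S\<close> of the pairs gives two sets,
  \<open>C \<union> S\<close> and \<open>C \<union> (D - S)\<close>. Replacing a part of
  \<open>S\<close> by its partners produces another transversal, so \<sigma> itself serves as the
  exchange bijection.\<close>

lemma exchange_bijection_if_pairing:
  assumes p: "pairing \<B> C D \<sigma>" and CD: "C \<inter> D = {}"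
  shows "\<exists>A B. \<B> A \<and> \<B> B \<and> bij_betw \<sigma> (A - B) (B - A) \<and> A \<inter> B = C \<and> A \<union> B = C \<union> D \<and>
    (\<forall>X\<subseteq>A - B. \<B> ((A - X) \<union> \<sigma> ` X))"
proof -
  note \<sigma> = pairing_involution[OF p]
  \<comment> \<open>\<open>SOME\<close> is applied to a set that is the same for \<open>x\<close>
    and \<open>\<sigma> x\<close>, so both members of a pair agree on its representative. The
    representatives form a transversal without any order on the elements.\<close>
  define S where "S = {x \<in> D. (SOME y. y \<in> {x, \<sigma> x}) = x}"
  have S: "x \<in> S \<longleftrightarrow> \<sigma> x \<notin> S" if "x \<in> D" for x
  proof -
    have "{\<sigma> x, \<sigma> (\<sigma> x)} = {x, \<sigma> x}" using \<sigma>(3)[OF that] by auto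
    moreover have "(SOME y. y \<in> {x, \<sigma> x}) \<in> {x, \<sigma> x}" by (rule someI[of _ x]) simp
    ultimately show ?thesis
      using \<sigma>[OF that] that unfolding S_def by (auto simp del: insert_iff)
  qed
  have SD: "S \<subseteq> D" unfolding S_def by blast
  have exch: "\<B> ((C \<union> S - X) \<union> \<sigma> ` X)" if X: "X \<subseteq> S" for X
  proof -
    have *: "x \<in> \<sigma> ` X \<longleftrightarrow> \<sigma> x \<in> X" if "x \<in> D" for x
      using \<sigma>[OF that] \<sigma>(3) X SD by (metis image_iff subsetD)
    have "\<B> (C \<union> ((S - X) \<union> \<sigma> ` X))"
    proof (rule pairing_transversal[OF p])
      show "S - X \<union> \<sigma> ` X \<subseteq> D" using X SD \<sigma> by blast
      fix x assume x: "x \<in> D"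
      show "x \<in> S - X \<union> \<sigma> ` X \<longleftrightarrow> \<sigma> x \<notin> S - X \<union> \<sigma> ` X"
        using S[OF x] *[OF x] *[OF \<sigma>(1)[OF x]] \<sigma>[OF x] X by auto
    qed
    moreover have "C \<union> ((S - X) \<union> \<sigma> ` X) = (C \<union> S - X) \<union> \<sigma> ` X"
      using X SD CD by blast
    ultimately show ?thesis by simp
  qed
  have img: "\<sigma> ` S = D - S"
  proof
    show "\<sigma> ` S \<subseteq> D - S" using S SD \<sigma> by blast
    show "D - S \<subseteq> \<sigma> ` S"
    proof
      fix x assume "x \<in> D - S"
      then have "\<sigma> x \<in> S" "\<sigma> (\<sigma> x) = x" using S \<sigma> by auto
      then show "x \<in> \<sigma> ` S" by force
    qed
  qed
  have "inj_on \<sigma> S"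
    using \<sigma>(3) SD by (metis inj_onI subsetD)
  then have bij: "bij_betw \<sigma> S (D - S)"
    using img by (simp add: bij_betw_def)
  define A where "A = C \<union> S"
  define B where "B = C \<union> (D - S)"
  have AB: "A - B = S" "B - A = D - S" "A \<inter> B = C" "A \<union> B = C \<union> D" "B = (A - S) \<union> \<sigma> ` S"
    using CD SD img unfolding A_def B_def by auto
  have "\<B> A" using exch[of "{}"] unfolding A_def by simp
  moreover have "\<B> B" using exch[of S] AB(5) unfolding A_def by simp
  ultimately show ?thesis
    using AB bij exch unfolding A_def[symmetric] by (intro exI[of _ A] exI[of _ B]) auto
qed

text \<open>The definition constrains \<open>A'\<close> and \<open>B'\<close> only through their
  intersection and union, hence through \<open>A \<inter> B\<close> and \<open>sym_diff A B\<close>.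
  Which member of a pair lies in \<open>A'\<close> is a free choice, and the right-hand side no
  longer mentions it.\<close>

lemma strongly_base_reorderable_iff_pairing:
  "strongly_base_reorderable M \<longleftrightarrow>
    (\<forall>A B. is_basis M A \<longrightarrow> is_basis M B \<longrightarrow>
      (\<exists>\<sigma>. pairing (is_basis M) (A \<inter> B) (sym_diff A B) \<sigma>))"
proof
  assume sbro: "strongly_base_reorderable M"
  show "\<forall>A B. is_basis M A \<longrightarrow> is_basis M B \<longrightarrow>
      (\<exists>\<sigma>. pairing (is_basis M) (A \<inter> B) (sym_diff A B) \<sigma>)"
  proof (intro allI impI)
    fix A B assume "is_basis M A" "is_basis M B"
    with sbro obtain A' B' \<phi> where
      *: "bij_betw \<phi> (A' - B') (B' - A')" "A' \<inter> B' = A \<inter> B" "A' \<union> B' = A \<union> B"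
        "\<forall>X. X \<subseteq> A' - B' \<longrightarrow> is_basis M ((A' - X) \<union> \<phi> ` X)"
      unfolding strongly_base_reorderable_def by metis
    have "sym_diff A' B' = sym_diff A B" using *(2,3) by blast
    with pairing_if_exchange_bijection[of \<phi> A' B' "is_basis M"] * show
      "\<exists>\<sigma>. pairing (is_basis M) (A \<inter> B) (sym_diff A B) \<sigma>" by simp
  qed
next
  assume R: "\<forall>A B. is_basis M A \<longrightarrow> is_basis M B \<longrightarrow>
      (\<exists>\<sigma>. pairing (is_basis M) (A \<inter> B) (sym_diff A B) \<sigma>)"
  show "strongly_base_reorderable M"
    unfolding strongly_base_reorderable_def
  proof (intro allI impI)
    fix A B assume "is_basis M A" "is_basis M B"
    with R obtain \<sigma> where "pairing (is_basis M) (A \<inter> B) (sym_diff A B) \<sigma>" by blast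
    moreover have "(A \<inter> B) \<inter> sym_diff A B = {}" "(A \<inter> B) \<union> sym_diff A B = A \<union> B" by auto
    ultimately obtain A' B' where "is_basis M A'" "is_basis M B'"
      "bij_betw \<sigma> (A' - B') (B' - A')" "A' \<inter> B' = A \<inter> B" "A' \<union> B' = A \<union> B"
      "\<forall>X\<subseteq>A' - B'. is_basis M ((A' - X) \<union> \<sigma> ` X)"
      using exchange_bijection_if_pairing[of "is_basis M" "A \<inter> B" "sym_diff A B" \<sigma>] by auto
    then show "\<exists>A' B' \<phi>. is_basis M A' \<and> is_basis M B' \<and>
        bij_betw \<phi> (A' - B') (B' - A') \<and>
        A' \<inter> B' = A \<inter> B \<and> A' \<union> B' = A \<union> B \<and>
        (\<forall>X. X \<subseteq> A' - B' \<longrightarrow> is_basis M ((A' - X) \<union> \<phi> ` X))"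
      by (intro exI[of _ A'] exI[of _ B'] exI[of _ \<sigma>]) simp
  qed
qed

locale sbro_matroid = matroid +
  assumes sbro: "strongly_base_reorderable M"
begin

lemma basis_pairing:
  assumes "is_basis M A" "is_basis M B"
  obtains \<sigma> where "pairing (is_basis M) (A \<inter> B) (sym_diff A B) \<sigma>"
  using sbro assms unfolding strongly_base_reorderable_iff_pairing by blast

end

lemma sbro_matroidI:
  assumes "matroid M"
    and "\<And>A B. is_basis M A \<Longrightarrow> is_basis M B \<Longrightarrow>
      \<exists>\<sigma>. pairing (is_basis M) (A \<inter> B) (sym_diff A B) \<sigma>"
  shows "sbro_matroid M"
  using assms unfolding sbro_matroid_axioms_def sbro_matroid_def strongly_base_reorderable_iff_pairing
  by blast

subsection \<open>Duals and minors\<close>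

context matroid
begin

text \<open>For augmentation, let \<open>A\<close> avoid \<open>X\<close> and \<open>B\<close> avoid
  \<open>Y\<close>. Extending \<open>B - X\<close> inside \<open>A\<close> gives a basis
  \<open>C\<close> that still avoids \<open>X\<close>. If \<open>C\<close> contained all of
  \<open>Y - X\<close>, comparing its size with that of \<open>B\<close> would give
  \<open>card (Y - X) \<le> card (B \<inter> X) \<le> card (X - Y)\<close>, against
  \<open>card X < card Y\<close>.\<close>

lemma matroid_dual: "matroid (dual_matroid M)"
proof
  show "finite (ground (dual_matroid M))"
    using finite_ground by (simp add: dual_matroid_def)
  show "X \<subseteq> ground (dual_matroid M)" if "X \<in> indeps (dual_matroid M)" for X
    using that by (auto simp: dual_matroid_def)
  show "{} \<in> indeps (dual_matroid M)"
    using basis_exists by (auto simp: dual_matroid_def)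
  show "Y \<in> indeps (dual_matroid M)" if "X \<in> indeps (dual_matroid M)" "Y \<subseteq> X" for X Y
    using that by (auto simp: dual_matroid_def)
  show "\<exists>y\<in>Y - X. insert y X \<in> indeps (dual_matroid M)"
    if X: "X \<in> indeps (dual_matroid M)" and Y: "Y \<in> indeps (dual_matroid M)"
      and lt: "card X < card Y" for X Y
  proof -
    obtain A B where A: "is_basis M A" "X \<subseteq> ground M - A" and B: "is_basis M B" "Y \<subseteq> ground M - B"
      using X Y by (auto simp: dual_matroid_def)
    have "B - X \<in> indeps M"
      using B indep_subset[of B] unfolding is_basis_def by blast
    then obtain C where C: "is_basis M C" "B - X \<subseteq> C" "C \<subseteq> (B - X) \<union> A"
      using indep_extend[OF A(1)] by blast
    have fin: "finite X" "finite Y" "finite B" "finite C"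
      using A(2) B(2) finite_ground basis_subset_ground[OF B(1)] basis_subset_ground[OF C(1)]
      by (auto intro: finite_subset)
    have "\<exists>y. y \<in> Y - X \<and> y \<notin> C"
    proof (rule ccontr)
      assume "\<not> ?thesis"
      then have sub: "(B - X) \<union> (Y - X) \<subseteq> C" using C by blast
      have "card (B - X) + card (Y - X) = card ((B - X) \<union> (Y - X))"
        using fin B(2) by (intro card_Un_disjoint[symmetric]) auto
      also have "\<dots> \<le> card C" using sub fin by (simp add: card_mono)
      also have "\<dots> = card B" using C(1) B(1) basis_card_eq by blast
      also have "\<dots> = card (B - X) + card (B \<inter> X)"
        using fin by (simp add: card_Diff_subset_Int card_mono)
      finally have "card (Y - X) \<le> card (B \<inter> X)" by simp
      also have "\<dots> \<le> card (X - Y)" using B(2) fin by (intro card_mono) auto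
      finally show False
        using lt card_Int_Diff[of X Y] card_Int_Diff[of Y X] fin by (simp add: Int_commute)
    qed
    then obtain y where y: "y \<in> Y - X" "y \<notin> C" by blast
    have "insert y X \<subseteq> ground M - C" using y C A B by blast
    then have "insert y X \<in> indeps (dual_matroid M)"
      using C(1) by (auto simp: dual_matroid_def)
    with y show ?thesis by blast
  qed
qed

lemma basis_dual_iff:
  "is_basis (dual_matroid M) X \<longleftrightarrow> X \<subseteq> ground M \<and> is_basis M (ground M - X)"
proof
  assume X: "is_basis (dual_matroid M) X"
  then obtain B where B: "is_basis M B" "X \<subseteq> ground M - B"
    by (auto simp: dual_matroid_def is_basis_def)
  then have "ground M - B \<in> indeps (dual_matroid M)" by (auto simp: dual_matroid_def)
  then have "ground M - B = X" using X B(2) unfolding is_basis_def by blast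
  with B basis_subset_ground[OF B(1)] show "X \<subseteq> ground M \<and> is_basis M (ground M - X)"
    by (auto simp: double_diff)
next
  assume X: "X \<subseteq> ground M \<and> is_basis M (ground M - X)"
  have "Y = X" if Y: "is_basis M B" "Y \<subseteq> ground M - B" "X \<subseteq> Y" for Y B
  proof -
    have "B \<subseteq> ground M - X" using Y basis_subset_ground by blast
    then have "B = ground M - X" using X Y(1) unfolding is_basis_def by metis
    then show ?thesis using Y X by blast
  qed
  with X show "is_basis (dual_matroid M) X"
    unfolding is_basis_def[of "dual_matroid M"] by (auto simp: dual_matroid_def)
qed

lemma matroid_deletion: "matroid (deletion M D)"
proof
  show "\<exists>y\<in>Y - X. insert y X \<in> indeps (deletion M D)"
    if "X \<in> indeps (deletion M D)" "Y \<in> indeps (deletion M D)" "card X < card Y" for X Y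
    using that augmentation[of X Y] by (auto simp: deletion_def)
  show "Y \<in> indeps (deletion M D)" if "X \<in> indeps (deletion M D)" "Y \<subseteq> X" for X Y
    using that indep_subset[of X Y] by (auto simp: deletion_def)
  show "X \<subseteq> ground (deletion M D)" if "X \<in> indeps (deletion M D)" for X
    using that indeps_subset_ground[of X] by (auto simp: deletion_def)
qed (use finite_ground empty_indep in \<open>auto simp: deletion_def\<close>)

end

context sbro_matroid
begin

lemma sbro_dual: "sbro_matroid (dual_matroid M)"
proof (rule sbro_matroidI[OF matroid_dual])
  fix A B assume "is_basis (dual_matroid M) A" "is_basis (dual_matroid M) B"
  then have A: "A \<subseteq> ground M" "is_basis M (ground M - A)"
    and B: "B \<subseteq> ground M" "is_basis M (ground M - B)"
    by (auto simp: basis_dual_iff)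
  let ?C = "(ground M - A) \<inter> (ground M - B)" and ?D = "sym_diff A B"
  have "sym_diff (ground M - A) (ground M - B) = ?D" using A B by blast
  then obtain \<sigma> where p: "pairing (is_basis M) ?C ?D \<sigma>"
    using basis_pairing[OF A(2) B(2)] by metis
  have "pairing (is_basis (dual_matroid M)) (A \<inter> B) ?D \<sigma>"
  proof (rule pairingI)
    fix T assume T: "T \<subseteq> ?D" "\<And>x. x \<in> ?D \<Longrightarrow> x \<in> T \<longleftrightarrow> \<sigma> x \<notin> T"
    \<comment> \<open>Passing to complements of bases replaces a transversal by its complement in
      \<open>?D\<close>, which is again a transversal of the same pairs.\<close>
    have "is_basis M (?C \<union> (?D - T))"
    proof (rule pairing_transversal[OF p])
      show "x \<in> ?D - T \<longleftrightarrow> \<sigma> x \<notin> ?D - T" if "x \<in> ?D" for x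
        using T(2)[OF that] pairing_involution[OF p that] that by blast
    qed blast
    moreover have "?C \<union> (?D - T) = ground M - (A \<inter> B \<union> T)" using A B T by blast
    ultimately show "is_basis (dual_matroid M) (A \<inter> B \<union> T)"
      using A B T by (auto simp: basis_dual_iff)
  qed (use pairing_involution[OF p] in blast)
  then show "\<exists>\<sigma>. pairing (is_basis (dual_matroid M)) (A \<inter> B) ?D \<sigma>" by blast
qed

text \<open>Both bases extend to bases of \<open>M\<close> by one and the same set
  \<open>C \<subseteq> D\<close>. If \<open>C\<close> completes \<open>A\<close>, then
  \<open>B\<close> can be completed within \<open>B \<union> A \<union> C\<close>. As
  \<open>B\<close> is maximal outside \<open>D\<close>, only elements of \<open>C\<close> are added,
  and by cardinality all of them are. A pairing for \<open>A \<union> C\<close> and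
  \<open>B \<union> C\<close> then has \<open>C\<close> in its intersection, and \<open>C\<close>
  can be removed from every transversal set.\<close>

lemma sbro_deletion: "sbro_matroid (deletion M D)"
proof (rule sbro_matroidI[OF matroid_deletion])
  interpret N: matroid "deletion M D" by (rule matroid_deletion)
  fix A B assume A: "is_basis (deletion M D) A" and B: "is_basis (deletion M D) B"
  have ind: "X \<in> indeps M" "X \<inter> D = {}" "\<And>x. x \<notin> D \<Longrightarrow> x \<notin> X \<Longrightarrow> insert x X \<notin> indeps M"
    if "is_basis (deletion M D) X" for X
    using that by (auto simp: is_basis_def deletion_def)
  obtain A1 where A1: "is_basis M A1" "A \<subseteq> A1"
    using ind(1)[OF A] by (meson basis_exists indep_extend)
  define C where "C = A1 - A"
  have outside: "Y - X \<subseteq> D" if "is_basis (deletion M D) X" "Y \<in> indeps M" "X \<subseteq> Y" for X Y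
    using ind(3)[OF that(1)] that indep_subset[of Y] by blast
  have CD: "C \<subseteq> D" "A1 = A \<union> C" "C \<inter> A = {}"
    using outside[OF A, of A1] A1 unfolding C_def is_basis_def by auto
  obtain B1 where B1: "is_basis M B1" "B \<subseteq> B1" "B1 \<subseteq> B \<union> A1"
    using ind(1)[OF B] A1 by (meson indep_extend)
  have "B1 - B \<subseteq> D" using outside[OF B, of B1] B1 unfolding is_basis_def by auto
  then have sub: "B1 \<subseteq> B \<union> C" using B1 CD ind(2)[OF A] by blast
  have fin: "finite A" "finite B" "finite C"
    using A1(1) indep_finite ind(1)[OF A] ind(1)[OF B]
    unfolding C_def is_basis_def by auto
  have "card (B \<union> C) = card A1"
    using CD ind(2)[OF B] fin N.basis_card_eq[OF A B]
    by (subst CD(2), subst (1 2) card_Un_disjoint) auto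
  then have "card B1 = card (B \<union> C)"
    using basis_card_eq[OF A1(1) B1(1)] by simp
  then have "B1 = B \<union> C"
    using sub fin by (simp add: card_subset_eq)
  then have BC: "is_basis M (B \<union> C)" and AC: "is_basis M (A \<union> C)"
    using B1 A1 CD by auto
  have eq: "(A \<union> C) \<inter> (B \<union> C) = A \<inter> B \<union> C" "sym_diff (A \<union> C) (B \<union> C) = sym_diff A B"
    using CD ind(2)[OF A] ind(2)[OF B] by auto
  obtain \<sigma> where p: "pairing (is_basis M) (A \<inter> B \<union> C) (sym_diff A B) \<sigma>"
    using basis_pairing[OF AC BC] unfolding eq by blast
  have "pairing (is_basis (deletion M D)) (A \<inter> B) (sym_diff A B) \<sigma>"
  proof (rule pairingI)
    fix T assume T: "T \<subseteq> sym_diff A B" "\<And>x. x \<in> sym_diff A B \<Longrightarrow> x \<in> T \<longleftrightarrow> \<sigma> x \<notin> T"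
    let ?X = "A \<inter> B \<union> T"
    have "is_basis M (A \<inter> B \<union> C \<union> T)"
      using pairing_transversal[OF p T] .
    moreover have "A \<inter> B \<union> C \<union> T = ?X \<union> C" by blast
    ultimately have X: "is_basis M (?X \<union> C)" by simp
    have XD: "?X \<inter> D = {}" using T ind(2)[OF A] ind(2)[OF B] by blast
    have fX: "finite ?X" using T fin by (auto intro: finite_subset)
    have "card ?X + card C = card (?X \<union> C)"
      using XD CD fin fX by (intro card_Un_disjoint[symmetric]) auto
    also have "\<dots> = card (A \<union> C)" using basis_card_eq X AC by blast
    also have "\<dots> = card A + card C" using CD fin by (intro card_Un_disjoint) auto
    finally have "card ?X = card A" by simp
    moreover have "?X \<in> indeps (deletion M D)"
      using X XD indep_subset[of "?X \<union> C" ?X] by (simp add: deletion_def is_basis_def)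
    ultimately show "is_basis (deletion M D) ?X"
      using N.basis_iff_card[OF A] by simp
  qed (use pairing_involution[OF p] in blast)
  then show "\<exists>\<sigma>. pairing (is_basis (deletion M D)) (A \<inter> B) (sym_diff A B) \<sigma>" by blast
qed

lemma sbro_contraction: "sbro_matroid (contraction M C)"
  unfolding contraction_def
  by (rule sbro_matroid.sbro_dual[OF sbro_matroid.sbro_deletion[OF sbro_dual]])

lemma sbro_minor: "is_minor N M \<Longrightarrow> sbro_matroid N"
  unfolding is_minor_def using sbro_matroid.sbro_deletion[OF sbro_contraction] by auto

end

subsection \<open>Direct sums\<close>

lemma matroid_direct_sum:
  assumes "matroid M" "matroid N" "ground M \<inter> ground N = {}"
  shows "matroid (direct_sum M N)"
    and "is_basis (direct_sum M N) X \<longleftrightarrow> X \<subseteq> ground M \<union> ground N \<and>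
      is_basis M (X \<inter> ground M) \<and> is_basis N (X \<inter> ground N)"
proof -
  interpret M: matroid M by fact
  interpret N: matroid N by fact
  let ?E = "ground M" and ?F = "ground N"
  have ind: "X \<in> indeps (direct_sum M N) \<longleftrightarrow>
      X \<subseteq> ?E \<union> ?F \<and> X \<inter> ?E \<in> indeps M \<and> X \<inter> ?F \<in> indeps N" for X
  proof
    assume "X \<in> indeps (direct_sum M N)"
    then obtain Y Z where YZ: "X = Y \<union> Z" "Y \<in> indeps M" "Z \<in> indeps N"
      by (auto simp: direct_sum_def)
    then have "Y \<subseteq> ?E" "Z \<subseteq> ?F"
      using M.indeps_subset_ground N.indeps_subset_ground by auto
    then have "X \<inter> ?E = Y" "X \<inter> ?F = Z" "X \<subseteq> ?E \<union> ?F" using YZ assms(3) by auto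
    then show "X \<subseteq> ?E \<union> ?F \<and> X \<inter> ?E \<in> indeps M \<and> X \<inter> ?F \<in> indeps N" using YZ by simp
  next
    assume X: "X \<subseteq> ?E \<union> ?F \<and> X \<inter> ?E \<in> indeps M \<and> X \<inter> ?F \<in> indeps N"
    then have "X = (X \<inter> ?E) \<union> (X \<inter> ?F)" by blast
    with X show "X \<in> indeps (direct_sum M N)" by (auto simp: direct_sum_def)
  qed
  show "matroid (direct_sum M N)"
  proof
    show "finite (ground (direct_sum M N))"
      using M.finite_ground N.finite_ground by (simp add: direct_sum_def)
    show "X \<subseteq> ground (direct_sum M N)" if "X \<in> indeps (direct_sum M N)" for X
      using that unfolding ind by (simp add: direct_sum_def)
    show "{} \<in> indeps (direct_sum M N)"
      unfolding ind using M.empty_indep N.empty_indep by simp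
    show "Y \<in> indeps (direct_sum M N)" if "X \<in> indeps (direct_sum M N)" "Y \<subseteq> X" for X Y
      using that M.indep_subset[of "X \<inter> ?E" "Y \<inter> ?E"] N.indep_subset[of "X \<inter> ?F" "Y \<inter> ?F"]
      unfolding ind by blast
    show "\<exists>y\<in>Y - X. insert y X \<in> indeps (direct_sum M N)"
      if X: "X \<in> indeps (direct_sum M N)" and Y: "Y \<in> indeps (direct_sum M N)"
        and lt: "card X < card Y" for X Y
    proof -
      have card: "card Z = card (Z \<inter> ?E) + card (Z \<inter> ?F)" if "Z \<subseteq> ?E \<union> ?F" for Z
      proof -
        have "Z = (Z \<inter> ?E) \<union> (Z \<inter> ?F)" using that by blast
        then have "card Z = card ((Z \<inter> ?E) \<union> (Z \<inter> ?F))" by simp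
        also have "\<dots> = card (Z \<inter> ?E) + card (Z \<inter> ?F)"
          using M.finite_ground N.finite_ground assms(3) by (intro card_Un_disjoint) auto
        finally show ?thesis .
      qed
      have XY: "X \<subseteq> ?E \<union> ?F" "Y \<subseteq> ?E \<union> ?F" using X Y unfolding ind by auto
      then consider "card (X \<inter> ?E) < card (Y \<inter> ?E)" | "card (X \<inter> ?F) < card (Y \<inter> ?F)"
        using lt card[of X] card[of Y] by linarith
      then show ?thesis
      proof cases
        case 1
        then obtain y where y: "y \<in> Y \<inter> ?E - X \<inter> ?E" "insert y (X \<inter> ?E) \<in> indeps M"
          using M.augmentation[of "X \<inter> ?E" "Y \<inter> ?E"] X Y unfolding ind by blast
        then have "insert y X \<inter> ?E = insert y (X \<inter> ?E)" "insert y X \<inter> ?F = X \<inter> ?F"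
          using assms(3) by auto
        then show ?thesis using y X XY unfolding ind by (intro bexI[of _ y]) auto
      next
        case 2
        then obtain y where y: "y \<in> Y \<inter> ?F - X \<inter> ?F" "insert y (X \<inter> ?F) \<in> indeps N"
          using N.augmentation[of "X \<inter> ?F" "Y \<inter> ?F"] X Y unfolding ind by blast
        then have "insert y X \<inter> ?F = insert y (X \<inter> ?F)" "insert y X \<inter> ?E = X \<inter> ?E"
          using assms(3) by auto
        then show ?thesis using y X XY unfolding ind by (intro bexI[of _ y]) auto
      qed
    qed
  qed
  show "is_basis (direct_sum M N) X \<longleftrightarrow>
    X \<subseteq> ?E \<union> ?F \<and> is_basis M (X \<inter> ?E) \<and> is_basis N (X \<inter> ?F)" (is "?L \<longleftrightarrow> ?R")
  proof
    assume L: ?L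
    then have X: "X \<subseteq> ?E \<union> ?F" "X \<inter> ?E \<in> indeps M" "X \<inter> ?F \<in> indeps N"
      unfolding is_basis_def ind by auto
    have max: "Z = X" if "Z \<in> indeps (direct_sum M N)" "X \<subseteq> Z" for Z
      using L that unfolding is_basis_def by blast
    have "Y = X \<inter> ?E" if Y: "Y \<in> indeps M" "X \<inter> ?E \<subseteq> Y" for Y
    proof -
      have YE: "Y \<subseteq> ?E" using Y M.indeps_subset_ground by blast
      then have "(Y \<union> X) \<inter> ?E = Y" "(Y \<union> X) \<inter> ?F = X \<inter> ?F" using Y assms(3) by auto
      then have "Y \<union> X = X" using YE X Y by (intro max) (auto simp: ind)
      with Y YE show ?thesis by blast
    qed
    moreover have "Y = X \<inter> ?F" if Y: "Y \<in> indeps N" "X \<inter> ?F \<subseteq> Y" for Y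
    proof -
      have YF: "Y \<subseteq> ?F" using Y N.indeps_subset_ground by blast
      then have "(Y \<union> X) \<inter> ?F = Y" "(Y \<union> X) \<inter> ?E = X \<inter> ?E" using Y assms(3) by auto
      then have "Y \<union> X = X" using YF X Y by (intro max) (auto simp: ind)
      with Y YF show ?thesis by blast
    qed
    ultimately show ?R using X unfolding is_basis_def by auto
  next
    assume R: ?R
    have "Y = X" if Y: "Y \<in> indeps (direct_sum M N)" "X \<subseteq> Y" for Y
    proof -
      have "Y \<inter> ?E = X \<inter> ?E" "Y \<inter> ?F = X \<inter> ?F"
        using R Y unfolding ind is_basis_def by (meson Int_mono order_refl)+
      then show ?thesis using Y R unfolding ind by blast
    qed
    moreover have "X \<in> indeps (direct_sum M N)"
      using R by (simp add: ind is_basis_def)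
    ultimately show ?L unfolding is_basis_def[of "direct_sum M N"] by blast
  qed
qed

lemma sbro_direct_sum:
  assumes "sbro_matroid M" "sbro_matroid N" and disj: "ground M \<inter> ground N = {}"
  shows "sbro_matroid (direct_sum M N)"
proof -
  interpret M: sbro_matroid M by fact
  interpret N: sbro_matroid N by fact
  let ?E = "ground M" and ?F = "ground N"
  note ds = matroid_direct_sum[OF M.matroid_axioms N.matroid_axioms disj]
  show ?thesis
  proof (rule sbro_matroidI[OF ds(1)])
    fix A B assume "is_basis (direct_sum M N) A" "is_basis (direct_sum M N) B"
    then have A: "A \<subseteq> ?E \<union> ?F" "is_basis M (A \<inter> ?E)" "is_basis N (A \<inter> ?F)"
      and B: "B \<subseteq> ?E \<union> ?F" "is_basis M (B \<inter> ?E)" "is_basis N (B \<inter> ?F)"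
      by (auto simp: ds(2))
    let ?D = "sym_diff A B"
    have eq: "sym_diff (A \<inter> G) (B \<inter> G) = ?D \<inter> G" "(A \<inter> G) \<inter> (B \<inter> G) = A \<inter> B \<inter> G" for G
      by auto
    obtain \<sigma> where s: "pairing (is_basis M) (A \<inter> B \<inter> ?E) (?D \<inter> ?E) \<sigma>"
      using M.basis_pairing[OF A(2) B(2)] unfolding eq by blast
    obtain \<tau> where t: "pairing (is_basis N) (A \<inter> B \<inter> ?F) (?D \<inter> ?F) \<tau>"
      using N.basis_pairing[OF A(3) B(3)] unfolding eq by blast
    \<comment> \<open>The two pairings live on disjoint ground sets, so they can be glued, and a
      transversal for the result restricts to a transversal on either side.\<close>
    define \<rho> where "\<rho> x = (if x \<in> ?E then \<sigma> x else \<tau> x)" for x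
    have \<rho>E: "\<rho> x = \<sigma> x" if "x \<in> ?E" for x using that by (simp add: \<rho>_def)
    have \<rho>F: "\<rho> x = \<tau> x" if "x \<in> ?F" for x using that disj by (auto simp: \<rho>_def)
    have "pairing (is_basis (direct_sum M N)) (A \<inter> B) ?D \<rho>"
    proof (rule pairingI)
      fix x assume x: "x \<in> ?D"
      then consider "x \<in> ?D \<inter> ?E" | "x \<in> ?D \<inter> ?F" using A B by blast
      then show "\<rho> x \<in> ?D \<and> \<rho> x \<noteq> x \<and> \<rho> (\<rho> x) = x"
      proof cases
        case 1
        with pairing_involution[OF s 1] show ?thesis by (simp add: \<rho>E)
      next
        case 2
        with pairing_involution[OF t 2] show ?thesis by (simp add: \<rho>F)
      qed
    next
      fix T assume T: "T \<subseteq> ?D" "\<And>x. x \<in> ?D \<Longrightarrow> x \<in> T \<longleftrightarrow> \<rho> x \<notin> T"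
      have "is_basis M (A \<inter> B \<inter> ?E \<union> (T \<inter> ?E))"
      proof (rule pairing_transversal[OF s])
        show "x \<in> T \<inter> ?E \<longleftrightarrow> \<sigma> x \<notin> T \<inter> ?E" if "x \<in> ?D \<inter> ?E" for x
          using T(2)[of x] pairing_involution[OF s that] that by (simp add: \<rho>E)
      qed (use T in blast)
      moreover have "is_basis N (A \<inter> B \<inter> ?F \<union> (T \<inter> ?F))"
      proof (rule pairing_transversal[OF t])
        show "x \<in> T \<inter> ?F \<longleftrightarrow> \<tau> x \<notin> T \<inter> ?F" if "x \<in> ?D \<inter> ?F" for x
          using T(2)[of x] pairing_involution[OF t that] that by (simp add: \<rho>F)
      qed (use T in blast)
      ultimately show "is_basis (direct_sum M N) (A \<inter> B \<union> T)"
        using A B T by (auto simp: ds(2) Int_Un_distrib2)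
    qed
    then show "\<exists>\<sigma>. pairing (is_basis (direct_sum M N)) (A \<inter> B) ?D \<sigma>" by blast
  qed
qed

subsection \<open>Truncations and principal extensions\<close>

context
  fixes \<B> :: "'a set \<Rightarrow> bool" and C D :: "'a set" and f g :: 'a and \<sigma> :: "'a \<Rightarrow> 'a"
  assumes fg: "f \<noteq> g" "f \<notin> C" "g \<notin> C"
begin

text \<open>The choice between \<open>f\<close> and \<open>g\<close> may depend on \<open>X\<close>;
  this slack is what makes re-pairing possible. The condition is symmetric in \<open>f\<close> and
  \<open>g\<close>, so the case with only \<open>g\<close> common needs no lemma of its own.\<close>

abbreviation (input) completable :: "'a set \<Rightarrow> bool" where
  "completable X \<equiv> \<exists>z\<in>{f, g}. z \<notin> X \<and> \<B> (insert z X)"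

text \<open>With \<open>f\<close> and \<open>g\<close> paired to each other, a transversal contains
  one of them and the other one completes it.\<close>

lemma pairing_complete_both_common:
  assumes p: "pairing \<B> (insert f (insert g C)) D \<sigma>" and D: "f \<notin> D" "g \<notin> D"
  shows "pairing completable C (insert f (insert g D)) (\<sigma>(f := g, g := f))" (is "pairing _ _ ?D ?\<tau>")
proof (rule pairingI)
  note \<sigma> = pairing_involution[OF p]
  show "?\<tau> x \<in> ?D \<and> ?\<tau> x \<noteq> x \<and> ?\<tau> (?\<tau> x) = x" if "x \<in> ?D" for x
    using that fg D \<sigma>[of x] by auto
  fix T assume T: "T \<subseteq> ?D" "\<And>x. x \<in> ?D \<Longrightarrow> x \<in> T \<longleftrightarrow> ?\<tau> x \<notin> T"
  define z where "z = (if f \<in> T then g else f)"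
  have z: "z \<in> {f, g}" "z \<notin> C \<union> T" "insert z (C \<union> T) = insert f (insert g C) \<union> (T - {f, g})"
    using T(2)[of f] fg unfolding z_def by auto
  have "\<B> (insert f (insert g C) \<union> (T - {f, g}))"
  proof (rule pairing_transversal[OF p])
    show "x \<in> T - {f, g} \<longleftrightarrow> \<sigma> x \<notin> T - {f, g}" if "x \<in> D" for x
    proof -
      have "x \<noteq> f" "x \<noteq> g" "\<sigma> x \<noteq> f" "\<sigma> x \<noteq> g" using that D \<sigma>(1)[OF that] by auto
      with T(2)[of x] that show ?thesis by simp
    qed
  qed (use T in blast)
  with z show "completable (C \<union> T)" by metis
qed

text \<open>The former partner of \<open>g\<close> is now paired with \<open>f\<close>. A
  transversal through \<open>f\<close> misses that partner, so \<open>g\<close> may be added; any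
  other transversal contains the partner and lacks only the common element \<open>f\<close>.\<close>

lemma pairing_complete_one_common:
  assumes p: "pairing \<B> (insert f C) D \<sigma>" and D: "f \<notin> D" "g \<in> D"
  shows "pairing completable C (insert f (D - {g})) (\<sigma>(f := \<sigma> g, \<sigma> g := f))"
    (is "pairing _ _ ?D ?\<tau>")
proof (rule pairingI)
  note \<sigma> = pairing_involution[OF p]
  show "?\<tau> x \<in> ?D \<and> ?\<tau> x \<noteq> x \<and> ?\<tau> (?\<tau> x) = x" if "x \<in> ?D" for x
    using that D \<sigma>[of x] \<sigma>[OF D(2)] by (cases "x \<in> D") auto
  fix T assume T: "T \<subseteq> ?D" "\<And>x. x \<in> ?D \<Longrightarrow> x \<in> T \<longleftrightarrow> ?\<tau> x \<notin> T"
  have c: "\<sigma> g \<in> D" "\<sigma> g \<noteq> f" "\<sigma> g \<noteq> g" using \<sigma>[OF D(2)] D by auto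
  have fT: "f \<in> T \<longleftrightarrow> \<sigma> g \<notin> T" using T(2)[of f] c by simp
  define z where "z = (if f \<in> T then g else f)"
  define S where "S = insert z T - {f}"
  have z: "z \<in> {f, g}" "z \<notin> C \<union> T" "insert z (C \<union> T) = insert f C \<union> S"
    using T(1) fg unfolding z_def S_def by auto
  have "\<B> (insert f C \<union> S)"
  proof (rule pairing_transversal[OF p])
    show "S \<subseteq> D" using T(1) D unfolding z_def S_def by auto
    fix x assume x: "x \<in> D"
    consider "x = g" | "x = \<sigma> g" | "x \<noteq> g" "x \<noteq> \<sigma> g" by blast
    then show "x \<in> S \<longleftrightarrow> \<sigma> x \<notin> S"
    proof cases
      case 3
      moreover have "x \<noteq> f" "\<sigma> x \<noteq> f" "\<sigma> x \<noteq> g" "\<sigma> x \<noteq> \<sigma> g"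
        using 3 x D \<sigma>[OF x] \<sigma>[OF D(2)] by metis+
      ultimately show ?thesis
        using T(2)[of x] x unfolding S_def z_def by auto
    qed (use T(1) fg fT c \<sigma>[OF D(2)] in \<open>auto simp: S_def z_def\<close>)
  qed
  with z show "completable (C \<union> T)" by metis
qed

text \<open>The pair of \<open>f\<close> and \<open>g\<close> simply disappears, and
  \<open>f\<close> completes every transversal of the remaining pairs.\<close>

lemma pairing_complete_paired:
  assumes p: "pairing \<B> C D \<sigma>" and D: "f \<in> D" "\<sigma> f = g"
  shows "pairing completable C (D - {f, g}) \<sigma>" (is "pairing _ _ ?D _")
proof (rule pairingI)
  note \<sigma> = pairing_involution[OF p]
  have stay: "\<sigma> x \<noteq> f" "\<sigma> x \<noteq> g" if "x \<in> ?D" for x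
    using that \<sigma>(3)[OF D(1)] \<sigma>[of x] D(2) by auto
  show "\<sigma> x \<in> ?D \<and> \<sigma> x \<noteq> x \<and> \<sigma> (\<sigma> x) = x" if "x \<in> ?D" for x
    using that \<sigma>[of x] stay[OF that] by blast
  fix T assume T: "T \<subseteq> ?D" "\<And>x. x \<in> ?D \<Longrightarrow> x \<in> T \<longleftrightarrow> \<sigma> x \<notin> T"
  have "\<B> (C \<union> insert f T)"
  proof (rule pairing_transversal[OF p])
    fix x assume x: "x \<in> D"
    consider "x = f" | "x = g" | "x \<in> ?D" using x by blast
    then show "x \<in> insert f T \<longleftrightarrow> \<sigma> x \<notin> insert f T"
      using T(1) T(2)[of x] stay[of x] D(2) fg \<sigma>(3)[OF D(1)] by cases auto
  qed (use T D in blast)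
  moreover have "f \<notin> C \<union> T" using T fg by auto
  ultimately show "completable (C \<union> T)" by auto
qed

text \<open>The orphaned partners \<open>\<sigma> f\<close> and \<open>\<sigma> g\<close> are
  paired. A transversal through \<open>\<sigma> f\<close> misses \<open>\<sigma> g\<close> and is
  completed by \<open>g\<close>; one through \<open>\<sigma> g\<close> is completed by
  \<open>f\<close>.\<close>

lemma pairing_complete_unpaired:
  assumes p: "pairing \<B> C D \<sigma>" and D: "f \<in> D" "g \<in> D" "\<sigma> f \<noteq> g"
  shows "pairing completable C (D - {f, g}) (\<sigma>(\<sigma> f := \<sigma> g, \<sigma> g := \<sigma> f))" (is "pairing _ _ ?D ?\<tau>")
proof (rule pairingI)
  note \<sigma> = pairing_involution[OF p]
  have d: "\<sigma> f \<in> ?D" "\<sigma> g \<in> ?D" "\<sigma> f \<noteq> \<sigma> g" "\<sigma> (\<sigma> f) = f" "\<sigma> (\<sigma> g) = g"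
    using \<sigma>[OF D(1)] \<sigma>[OF D(2)] D(3) fg by auto
  have stay: "\<sigma> x \<notin> {f, g, \<sigma> f, \<sigma> g}" if "x \<in> ?D" "x \<noteq> \<sigma> f" "x \<noteq> \<sigma> g" for x
    using that \<sigma>[of x] d by auto
  show "?\<tau> x \<in> ?D \<and> ?\<tau> x \<noteq> x \<and> ?\<tau> (?\<tau> x) = x" if "x \<in> ?D" for x
  proof (cases "x = \<sigma> f \<or> x = \<sigma> g")
    case False
    with stay[of x] \<sigma>[of x] that show ?thesis by auto
  qed (use d in auto)
  fix T assume T: "T \<subseteq> ?D" "\<And>x. x \<in> ?D \<Longrightarrow> x \<in> T \<longleftrightarrow> ?\<tau> x \<notin> T"
  have one: "\<sigma> f \<in> T \<longleftrightarrow> \<sigma> g \<notin> T" using T(2)[OF d(1)] d by simp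
  define z where "z = (if \<sigma> f \<in> T then g else f)"
  have z: "z \<in> {f, g}" "z \<notin> C \<union> T" using T(1) fg unfolding z_def by auto
  have "\<B> (C \<union> insert z T)"
  proof (rule pairing_transversal[OF p])
    show "insert z T \<subseteq> D" using T D z by auto
    fix x assume x: "x \<in> D"
    consider "x = f" | "x = g" | "x = \<sigma> f" | "x = \<sigma> g" | "x \<in> ?D" "x \<noteq> \<sigma> f" "x \<noteq> \<sigma> g"
      using x by blast
    then show "x \<in> insert z T \<longleftrightarrow> \<sigma> x \<notin> insert z T"
    proof cases
      case 5
      with stay[OF 5] T(2)[of x] show ?thesis unfolding z_def by auto
    qed (use T(1) one d fg in \<open>auto simp: z_def\<close>)
  qed
  with z show "completable (C \<union> T)" by (metis Un_insert_right)
qed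

end

text \<open>
  The partners of \<open>f\<close> and \<open>g\<close> (an element of the intersection counts as its own partner)
  become partners of each other: a transversal contains exactly one of them, and misses
  only \<open>g\<close> or \<open>f\<close>, respectively, to be a transversal of the original pairs.
\<close>
lemma pairing_complete:
  assumes f: "f \<notin> I" and g: "g \<notin> J"
    and p: "pairing \<B> (insert f I \<inter> insert g J) (sym_diff (insert f I) (insert g J)) \<sigma>"
  shows "\<exists>\<tau>. pairing (\<lambda>X. \<exists>z\<in>{f, g}. z \<notin> X \<and> \<B> (insert z X)) (I \<inter> J) (sym_diff I J) \<tau>"
proof (cases "f = g")
  case True
  then have eq: "insert f I \<inter> insert g J = insert f (I \<inter> J)"
    "sym_diff (insert f I) (insert g J) = sym_diff I J"
    using f g by auto
  have "pairing (\<lambda>X. \<exists>z\<in>{f, g}. z \<notin> X \<and> \<B> (insert z X)) (I \<inter> J) (sym_diff I J) \<sigma>"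
  proof (rule pairingI)
    fix T assume T: "T \<subseteq> sym_diff I J" "\<And>x. x \<in> sym_diff I J \<Longrightarrow> x \<in> T \<longleftrightarrow> \<sigma> x \<notin> T"
    have "\<B> (insert f (I \<inter> J) \<union> T)"
      using p T unfolding eq by (rule pairing_transversal)
    moreover have "f \<notin> I \<inter> J \<union> T" using T(1) f g True by auto
    ultimately show "\<exists>z\<in>{f, g}. z \<notin> I \<inter> J \<union> T \<and> \<B> (insert z (I \<inter> J \<union> T))" by auto
  qed (use pairing_involution[OF p] in \<open>simp add: eq\<close>)
  then show ?thesis by blast
next
  case False
  note fg = False
  have C: "f \<notin> I \<inter> J" "g \<notin> I \<inter> J" using f g by auto
  \<comment> \<open>For distinct \<open>f\<close> and \<open>g\<close>, \<open>f \<in> J\<close>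
    says that \<open>f\<close> is common to the two large bases rather than in their symmetric
    difference; \<open>g \<in> I\<close> says the same of \<open>g\<close>.\<close>
  consider "f \<in> J" "g \<in> I" | "f \<in> J" "g \<notin> I" | "f \<notin> J" "g \<in> I" | "f \<notin> J" "g \<notin> I"
    by blast
  then show ?thesis
  proof cases
    case 1
    let ?D = "sym_diff I J - {f, g}"
    have eq: "insert f I \<inter> insert g J = insert f (insert g (I \<inter> J))"
      "sym_diff (insert f I) (insert g J) = ?D" "insert f (insert g ?D) = sym_diff I J"
      using 1 f g by auto
    have "f \<notin> ?D" "g \<notin> ?D" by auto
    from pairing_complete_both_common[OF fg C p[unfolded eq(1,2)] this] show ?thesis
      unfolding eq(3) by blast
  next
    case 2
    let ?D = "insert g (sym_diff I J - {f})"
    have eq: "insert f I \<inter> insert g J = insert f (I \<inter> J)"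
      "sym_diff (insert f I) (insert g J) = ?D" "insert f (?D - {g}) = sym_diff I J"
      using 2 f g fg by auto
    have "f \<notin> ?D" "g \<in> ?D" using fg by auto
    from pairing_complete_one_common[OF fg C p[unfolded eq(1,2)] this] show ?thesis
      unfolding eq(3) by blast
  next
    case 3
    let ?D = "insert f (sym_diff I J - {g})"
    have eq: "insert f I \<inter> insert g J = insert g (I \<inter> J)"
      "sym_diff (insert f I) (insert g J) = ?D" "insert g (?D - {f}) = sym_diff I J"
      using 3 f g fg by auto
    have "g \<notin> ?D" "f \<in> ?D" using fg by auto
    from pairing_complete_one_common[OF fg[symmetric] C(2,1) p[unfolded eq(1,2)] this]
    show ?thesis unfolding eq(3) insert_commute[of g f] by blast
  next
    case 4
    let ?D = "insert f (insert g (sym_diff I J))"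
    have eq: "insert f I \<inter> insert g J = I \<inter> J"
      "sym_diff (insert f I) (insert g J) = ?D" "?D - {f, g} = sym_diff I J"
      using 4 f g fg by auto
    have D: "f \<in> ?D" "g \<in> ?D" by auto
    show ?thesis
    proof (cases "\<sigma> f = g")
      case True
      from pairing_complete_paired[OF fg C p[unfolded eq(1,2)] D(1) True] show ?thesis
        unfolding eq(3) by blast
    next
      case False
      from pairing_complete_unpaired[OF fg C p[unfolded eq(1,2)] D False] show ?thesis
        unfolding eq(3) by blast
    qed
  qed
qed

section \<open>Truncations\<close>

lemma (in matroid) matroid_truncation: "matroid (truncation k M)"
proof
  show "\<exists>y\<in>Y - X. insert y X \<in> indeps (truncation k M)"
    if X: "X \<in> indeps (truncation k M)" and Y: "Y \<in> indeps (truncation k M)"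
      and lt: "card X < card Y" for X Y
  proof -
    obtain y where y: "y \<in> Y - X" "insert y X \<in> indeps M"
      using augmentation[of X Y] X Y lt by (auto simp: truncation_def)
    moreover have "card (insert y X) \<le> k"
      using lt X Y y indep_finite[of X] by (simp add: truncation_def)
    ultimately show ?thesis by (auto simp: truncation_def)
  qed
  show "Y \<in> indeps (truncation k M)" if "X \<in> indeps (truncation k M)" "Y \<subseteq> X" for X Y
    using that indep_subset[of X Y] card_mono[of X Y] indep_finite[of X]
    by (simp add: truncation_def)
qed (use finite_ground indeps_subset_ground empty_indep in \<open>auto simp: truncation_def\<close>)

text \<open>When the rank is \<open>Suc k\<close>, the bases of the truncation are the bases of
  \<open>M\<close> with one element removed. The elements \<open>a\<close> and \<open>b\<close>
  missing from two of them may differ, and \<open>pairing_complete\<close> deals with exactly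
  this.\<close>

lemma (in sbro_matroid) sbro_truncation_step:
  assumes B0: "is_basis M B0" "card B0 = Suc k"
  shows "sbro_matroid (truncation k M)"
proof (rule sbro_matroidI[OF matroid_truncation])
  have basis_iff: "is_basis (truncation k M) X \<longleftrightarrow> (\<exists>z. z \<notin> X \<and> is_basis M (insert z X))" for X
  proof
    assume X: "is_basis (truncation k M) X"
    then have Xi: "X \<in> indeps M" "card X \<le> k" by (auto simp: is_basis_def truncation_def)
    then obtain z where z: "z \<in> B0 - X" "insert z X \<in> indeps M"
      using augmentation[of X B0] B0 by (auto simp: is_basis_def)
    have fX: "finite X" using Xi indep_finite by blast
    have "\<not> card (insert z X) \<le> k"
    proof
      assume "card (insert z X) \<le> k"
      with z have "insert z X \<in> indeps (truncation k M)" by (simp add: truncation_def)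
      with X z show False unfolding is_basis_def by blast
    qed
    then have "card (insert z X) = Suc k" using Xi(2) fX z by simp
    with z show "\<exists>z. z \<notin> X \<and> is_basis M (insert z X)"
      using basis_iff_card[OF B0(1)] B0(2) by auto
  next
    assume "\<exists>z. z \<notin> X \<and> is_basis M (insert z X)"
    then obtain z where z: "z \<notin> X" "is_basis M (insert z X)" by blast
    then have Xi: "X \<in> indeps M" using indep_subset[of "insert z X" X] by (auto simp: is_basis_def)
    have card: "card X = k"
      using z basis_card_eq[OF z(2) B0(1)] B0(2) indep_finite[OF Xi] by simp
    have "Y = X" if "Y \<in> indeps M" "card Y \<le> k" "X \<subseteq> Y" for Y
      using that card indep_finite card_seteq[of Y X] by auto
    with Xi card show "is_basis (truncation k M) X" by (auto simp: is_basis_def truncation_def)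
  qed
  fix A B assume "is_basis (truncation k M) A" "is_basis (truncation k M) B"
  then obtain a b where a: "a \<notin> A" "is_basis M (insert a A)" and b: "b \<notin> B" "is_basis M (insert b B)"
    unfolding basis_iff by blast
  obtain \<sigma> where "pairing (is_basis M) (insert a A \<inter> insert b B) (sym_diff (insert a A) (insert b B)) \<sigma>"
    using basis_pairing[OF a(2) b(2)] .
  from pairing_complete[OF a(1) b(1) this] obtain \<tau> where
    "pairing (\<lambda>X. \<exists>z\<in>{a, b}. z \<notin> X \<and> is_basis M (insert z X)) (A \<inter> B) (sym_diff A B) \<tau>" by blast
  then have "pairing (is_basis (truncation k M)) (A \<inter> B) (sym_diff A B) \<tau>"
    by (rule pairing_mono) (auto simp: basis_iff)
  then show "\<exists>\<tau>. pairing (is_basis (truncation k M)) (A \<inter> B) (sym_diff A B) \<tau>" by blast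
qed

lemma (in sbro_matroid) sbro_truncation: "sbro_matroid (truncation k M)"
proof -
  obtain B where B: "is_basis M B" by (rule basis_exists)
  have trivial: "truncation k N = N" if "\<And>X. X \<in> indeps N \<Longrightarrow> card X \<le> k" for k and N :: "'a pre_matroid"
  proof -
    have "{X \<in> indeps N. card X \<le> k} = indeps N" using that by auto
    then show ?thesis by (simp add: truncation_def)
  qed
  \<comment> \<open>\<open>d\<close> bounds how far \<open>k\<close> lies below the rank; the
    induction step reaches \<open>k\<close> from \<open>Suc k\<close>.\<close>
  have "sbro_matroid (truncation k M)" if "card B \<le> k + d" for d
    using that
  proof (induction d arbitrary: k)
    case 0
    then have "truncation k M = M"
      using basis_card_max[OF B] by (intro trivial) force
    then show ?case using sbro_matroid_axioms by simp
  next
    case (Suc d)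
    let ?N = "truncation (Suc k) M"
    interpret N: sbro_matroid ?N using Suc by simp
    have eq: "truncation k M = truncation k ?N" by (auto simp: truncation_def)
    obtain B' where B': "is_basis ?N B'" by (rule N.basis_exists)
    then have "card B' \<le> Suc k" by (simp add: is_basis_def truncation_def)
    \<comment> \<open>As \<open>d\<close> is only an upper bound, the rank may already be at most
      \<open>k\<close>, and then truncating changes nothing.\<close>
    then consider "card B' = Suc k" | "card B' \<le> k" by linarith
    then show ?case
    proof cases
      case 1
      then show ?thesis unfolding eq using N.sbro_truncation_step[OF B'] by simp
    next
      case 2
      then have "truncation k ?N = ?N"
        using N.basis_card_max[OF B'] by (intro trivial) force
      then show ?thesis unfolding eq using N.sbro_matroid_axioms by simp
    qed
  qed
  from this[of "card B"] show ?thesis by simp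
qed

section \<open>Principal extensions\<close>

text \<open>
  The new element \<open>e\<close> is placed freely on \<open>F\<close>; the extension is only meaningful for
  \<open>e\<close> outside the ground set.
\<close>
definition principal_extension :: "'a pre_matroid \<Rightarrow> 'a set \<Rightarrow> 'a \<Rightarrow> 'a pre_matroid" where
  "principal_extension M F e =
    \<lparr>ground = insert e (ground M),
     indeps = indeps M \<union> {insert e I | I. \<exists>f\<in>F. f \<notin> I \<and> insert f I \<in> indeps M}\<rparr>"

locale principal_extension_matroid = matroid +
  fixes F :: "'a set" and e :: 'a
  assumes e_new: "e \<notin> ground M"
begin

abbreviation "P \<equiv> principal_extension M F e"

lemma e_notin_indep: "X \<in> indeps M \<Longrightarrow> e \<notin> X"
  using e_new indeps_subset_ground by blast

lemma indep_old: "e \<notin> X \<Longrightarrow> X \<in> indeps P \<longleftrightarrow> X \<in> indeps M"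
  unfolding principal_extension_def by auto

lemma indep_new:
  assumes "e \<notin> I"
  shows "insert e I \<in> indeps P \<longleftrightarrow> (\<exists>f\<in>F. f \<notin> I \<and> insert f I \<in> indeps M)"
proof -
  have "insert e I = insert e J \<longleftrightarrow> I = J" if "insert f J \<in> indeps M" for f J
    using e_notin_indep[OF that] assms by auto
  moreover have "insert e I \<notin> indeps M" using e_notin_indep by blast
  ultimately show ?thesis unfolding principal_extension_def by auto
qed

lemma indep_new_cases:
  assumes "X \<in> indeps P" "e \<in> X"
  obtains I f where "X = insert e I" "e \<notin> I" "f \<in> F" "f \<notin> I" "insert f I \<in> indeps M"
proof -
  have X: "X = insert e (X - {e})" using assms by auto
  with assms indep_new[of "X - {e}"] obtain f where
    "f \<in> F" "f \<notin> X - {e}" "insert f (X - {e}) \<in> indeps M" by auto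
  with X that show ?thesis by blast
qed

text \<open>An independent set \<open>insert e I\<close> has a stand-in \<open>insert f I\<close> in
  \<open>M\<close> with \<open>f\<close> from \<open>F\<close>. Augmentation is carried out in
  \<open>M\<close> on the stand-ins; the work lies in the cases where the augmenting element is
  itself a stand-in for \<open>e\<close>.\<close>

lemma matroid_principal_extension: "matroid P"
proof
  show "finite (ground P)" using finite_ground by (simp add: principal_extension_def)
  show "{} \<in> indeps P" using empty_indep by (simp add: principal_extension_def)
  show "X \<subseteq> ground P" if "X \<in> indeps P" for X
    using that indeps_subset_ground by (fastforce simp: principal_extension_def)
  show "Y \<in> indeps P" if X: "X \<in> indeps P" and YX: "Y \<subseteq> X" for X Y
  proof (cases "e \<in> X")
    case False
    then have "e \<notin> Y" using YX by blast
    with False X YX show ?thesis using indep_subset by (simp add: indep_old)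
  next
    case True
    with X obtain I f where I: "X = insert e I" "e \<notin> I" "f \<in> F" "f \<notin> I" "insert f I \<in> indeps M"
      by (rule indep_new_cases)
    have sub: "insert f (Y - {e}) \<in> indeps M" "Y - {e} \<in> indeps M"
      using I YX by (auto intro: indep_subset[OF I(5)])
    show ?thesis
    proof (cases "e \<in> Y")
      case True
      then have "Y = insert e (Y - {e})" by auto
      moreover have "insert e (Y - {e}) \<in> indeps P"
        using sub I YX by (subst indep_new) auto
      ultimately show ?thesis by simp
    next
      case False
      then show ?thesis using sub by (simp add: indep_old)
    qed
  qed
  show "\<exists>y\<in>Y - X. insert y X \<in> indeps P"
    if X: "X \<in> indeps P" and Y: "Y \<in> indeps P" and lt: "card X < card Y" for X Y
  proof (cases "e \<in> X")
    case eX: False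
    show ?thesis
    proof (cases "e \<in> Y")
      case False
      then obtain y where "y \<in> Y - X" "insert y X \<in> indeps M"
        using augmentation[of X Y] X Y eX lt by (auto simp: indep_old)
      then show ?thesis by (auto simp: principal_extension_def)
    next
      case True
      with Y obtain J g where J: "Y = insert e J" "e \<notin> J" "g \<in> F" "g \<notin> J" "insert g J \<in> indeps M"
        by (rule indep_new_cases)
      have "card X < card (insert g J)"
        using lt J indep_finite[OF J(5)] by simp
      then obtain y where y: "y \<in> insert g J - X" "insert y X \<in> indeps M"
        using augmentation[of X "insert g J"] X J eX by (auto simp: indep_old)
      \<comment> \<open>If the element found is \<open>g\<close>, the stand-in for \<open>e\<close>,
        then \<open>e\<close> itself augments \<open>X\<close>.\<close>
      show ?thesis
      proof (cases "y = g")
        case True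
        then have "insert e X \<in> indeps P" using y J eX by (auto simp: indep_new)
        then show ?thesis using J eX by blast
      next
        case False
        then show ?thesis using y J by (intro bexI[of _ y]) (auto simp: principal_extension_def)
      qed
    qed
  next
    case True
    with X obtain I f where I: "X = insert e I" "e \<notin> I" "f \<in> F" "f \<notin> I" "insert f I \<in> indeps M"
      by (rule indep_new_cases)
    have fI: "finite I" using indep_finite[OF I(5)] by simp
    have *: ?thesis if y: "y \<in> Y - X" and f: "f \<in> F" "f \<notin> insert y I" "insert f (insert y I) \<in> indeps M" for y f
    proof -
      have "insert e (insert y I) \<in> indeps P"
        using y I f by (subst indep_new) auto
      then show ?thesis using y I by (auto simp: insert_commute)
    qed
    show ?thesis
    proof (cases "e \<in> Y")
      case eY: False
      then have "card (insert f I) < card Y" "Y \<in> indeps M"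
        using lt I fI Y by (simp_all add: indep_old)
      then obtain y where "y \<in> Y - insert f I" "insert y (insert f I) \<in> indeps M"
        using augmentation[OF I(5)] by blast
      then show ?thesis
        using eY I by (intro *[of y f]) (auto simp: insert_commute)
    next
      case True
      with Y obtain J g where J: "Y = insert e J" "e \<notin> J" "g \<in> F" "g \<notin> J" "insert g J \<in> indeps M"
        by (rule indep_new_cases)
      have fJ: "finite J" using indep_finite[OF J(5)] by simp
      have lt': "card I < card J" using lt I J fI fJ by simp
      then have "card (insert f I) < card (insert g J)" using I J fI fJ by simp
      then obtain y where y: "y \<in> insert g J - insert f I" "insert y (insert f I) \<in> indeps M"
        using augmentation[OF I(5) J(5)] by blast
      show ?thesis
      proof (cases "y \<in> J")
        case True
        then show ?thesis using y I J by (intro *[of y f]) (auto simp: insert_commute)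
      next
        case False
        \<comment> \<open>The element found is \<open>g\<close>, which is not in \<open>Y\<close>.
          But \<open>insert g (insert f I)\<close> is independent and two larger than
          \<open>I\<close>, so after augmenting \<open>I\<close> by some \<open>z\<close> from
          \<open>J\<close> there is still room for \<open>f\<close> or \<open>g\<close>. Either one
          lies in \<open>F\<close> and can stand in for \<open>e\<close>.\<close>
        then have g: "g \<notin> insert f I" "insert g (insert f I) \<in> indeps M" using y by auto
        have "I \<in> indeps M" "J \<in> indeps M" using I J by (auto intro: indep_subset)
        then obtain z where z: "z \<in> J - I" "insert z I \<in> indeps M"
          using augmentation lt' by blast
        have "card (insert z I) < card (insert g (insert f I))"
          using z g I fI by simp
        then obtain w where "w \<in> insert g (insert f I) - insert z I" "insert w (insert z I) \<in> indeps M"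
          using augmentation[OF z(2) g(2)] by blast
        then show ?thesis using z I J by (intro *[of z w]) auto
      qed
    qed
  qed
qed

text \<open>The extension does not raise the rank, because a set containing \<open>e\<close> has the
  same size as its stand-in. A basis of \<open>M\<close> therefore remains a basis, and all other
  bases are recognised by their size.\<close>

lemma basis_principal_extension_old:
  assumes "e \<notin> X"
  shows "is_basis P X \<longleftrightarrow> is_basis M X"
  and basis_principal_extension_new:
  "is_basis P (insert e X) \<longleftrightarrow> (\<exists>f\<in>F. f \<notin> X \<and> is_basis M (insert f X))"
proof -
  interpret P: matroid P by (rule matroid_principal_extension)
  obtain B where B: "is_basis M B" by (rule basis_exists)
  have eB: "e \<notin> B" using B e_notin_indep by (auto simp: is_basis_def)
  have le: "card Y \<le> card B" if Y: "Y \<in> indeps P" for Y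
  proof (cases "e \<in> Y")
    case True
    with Y obtain I f where I: "Y = insert e I" "e \<notin> I" "f \<in> F" "f \<notin> I" "insert f I \<in> indeps M"
      by (rule indep_new_cases)
    then show ?thesis using basis_card_max[OF B I(5)] indep_finite[OF I(5)] by simp
  qed (use basis_card_max[OF B] Y in \<open>auto simp: indep_old\<close>)
  have PB: "is_basis P B"
  proof -
    obtain C where C: "is_basis P C" "B \<subseteq> C"
      using P.basis_exists P.indep_extend[of _ B] B eB by (metis indep_old is_basis_def)
    then have "C = B" using le[of C] P.indep_finite[of C] card_seteq[of C B]
      by (auto simp: is_basis_def)
    with C show ?thesis by simp
  qed
  show "is_basis P X \<longleftrightarrow> is_basis M X"
    using P.basis_iff_card[OF PB, of X] basis_iff_card[OF B, of X] indep_old[OF assms] by simp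
  have "card (insert e X) = card (insert f X)" if "f \<notin> X" for f
    using that assms by (cases "finite X") auto
  then show "is_basis P (insert e X) \<longleftrightarrow> (\<exists>f\<in>F. f \<notin> X \<and> is_basis M (insert f X))"
    unfolding P.basis_iff_card[OF PB] basis_iff_card[OF B] indep_new[OF assms] by metis
qed

lemma basis_principal_extensionI:
  assumes "f \<in> F" "f \<notin> X" "e \<in> X" "is_basis M (insert f (X - {e}))"
  shows "is_basis P X"
proof -
  have "is_basis P (insert e (X - {e}))"
    using assms by (subst basis_principal_extension_new) auto
  then show ?thesis using assms by (simp add: insert_absorb)
qed

end

locale principal_extension_sbro = sbro_matroid + principal_extension_matroid
begin

text \<open>In a pairing for \<open>insert f I\<close> and \<open>B\<close>, the element
  \<open>e\<close> takes over from its stand-in \<open>f\<close>. If \<open>f\<close> lies in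
  \<open>B\<close>, then \<open>e\<close> and \<open>f\<close> become a pair: a transversal through
  \<open>f\<close> gives an old basis, one through \<open>e\<close> has \<open>f\<close> as
  stand-in. If \<open>f\<close> is not in \<open>B\<close>, then \<open>e\<close> inherits the
  partner of \<open>f\<close>.\<close>

lemma pairing_mixed_bases:
  assumes I: "e \<notin> I" "f \<in> F" "f \<notin> I" "is_basis M (insert f I)" and B: "is_basis M B"
  shows "\<exists>\<sigma>. pairing (is_basis P) (insert e I \<inter> B) (sym_diff (insert e I) B) \<sigma>"
proof -
  have e: "e \<notin> B" "e \<noteq> f" using B I e_notin_indep by (auto simp: is_basis_def)
  let ?C = "I \<inter> B"
  have C: "insert e I \<inter> B = ?C" "e \<notin> ?C" "f \<notin> ?C" using e I by auto
  obtain \<sigma> where p: "pairing (is_basis M) (insert f I \<inter> B) (sym_diff (insert f I) B) \<sigma>"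
    using basis_pairing[OF I(4) B] .
  show ?thesis
  proof (cases "f \<in> B")
    case True
    let ?D = "sym_diff I B - {f}"
    have eq: "insert f I \<inter> B = insert f ?C" "sym_diff (insert f I) B = ?D"
      "sym_diff (insert e I) B = insert e (insert f ?D)"
      using True I e by auto
    have D: "e \<notin> ?D" "f \<notin> ?D" using e I by auto
    note p = p[unfolded eq(1,2)]
    note \<sigma> = pairing_involution[OF p]
    let ?\<tau> = "\<sigma>(e := f, f := e)"
    have "pairing (is_basis P) ?C (insert e (insert f ?D)) ?\<tau>"
    proof (rule pairingI)
      show "?\<tau> x \<in> insert e (insert f ?D) \<and> ?\<tau> x \<noteq> x \<and> ?\<tau> (?\<tau> x) = x"
        if "x \<in> insert e (insert f ?D)" for x
      proof (cases "x \<in> ?D")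
        case True
        then have "x \<noteq> e" "x \<noteq> f" "\<sigma> x \<noteq> e" "\<sigma> x \<noteq> f" using D \<sigma>(1)[OF True] by auto
        then show ?thesis using \<sigma>[OF True] by simp
      qed (use that e in auto)
      fix T assume T: "T \<subseteq> insert e (insert f ?D)"
        "\<And>x. x \<in> insert e (insert f ?D) \<Longrightarrow> x \<in> T \<longleftrightarrow> ?\<tau> x \<notin> T"
      have ef: "e \<in> T \<longleftrightarrow> f \<notin> T" using T(2)[of e] e by simp
      have b: "is_basis M (insert f ?C \<union> (T - {e, f}))"
      proof (rule pairing_transversal[OF p])
        show "x \<in> T - {e, f} \<longleftrightarrow> \<sigma> x \<notin> T - {e, f}" if "x \<in> ?D" for x
        proof -
          have "x \<noteq> e" "x \<noteq> f" "\<sigma> x \<noteq> e" "\<sigma> x \<noteq> f" using that D \<sigma>(1)[OF that] by auto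
          with T(2)[of x] that show ?thesis by simp
        qed
      qed (use T in blast)
      show "is_basis P (?C \<union> T)"
      proof (cases "e \<in> T")
        case True
        have "insert f (?C \<union> T - {e}) = insert f ?C \<union> (T - {e, f})" using C(2) by auto
        then show ?thesis using b True ef C I(2) by (intro basis_principal_extensionI[of f]) auto
      next
        case False
        then have "?C \<union> T = insert f ?C \<union> (T - {e, f})" using ef by auto
        then show ?thesis using b False C(2) by (subst basis_principal_extension_old) auto
      qed
    qed
    then show ?thesis unfolding C(1) eq(3) by blast
  next
    case False
    let ?D = "insert f (sym_diff I B)"
    have eq: "insert f I \<inter> B = ?C" "sym_diff (insert f I) B = ?D"
      "sym_diff (insert e I) B = insert e (?D - {f})"
      using False I e by auto
    have D: "e \<notin> ?D" "f \<in> ?D" using e I by auto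
    note p = p[unfolded eq(1,2)]
    note \<sigma> = pairing_involution[OF p]
    have b: "\<sigma> f \<in> ?D - {f}" "\<sigma> (\<sigma> f) = f" using \<sigma>[OF D(2)] by auto
    then have be: "\<sigma> f \<noteq> e" using D(1) by auto
    let ?\<tau> = "\<sigma>(e := \<sigma> f, \<sigma> f := e)" and ?D' = "insert e (?D - {f})"
    have stay: "\<sigma> x \<noteq> e" "\<sigma> x \<noteq> f" "\<sigma> x \<noteq> \<sigma> f" if "x \<in> ?D" "x \<noteq> f" "x \<noteq> \<sigma> f" for x
    proof -
      show "\<sigma> x \<noteq> e" using D(1) \<sigma>(1)[OF that(1)] by auto
      show "\<sigma> x \<noteq> f" "\<sigma> x \<noteq> \<sigma> f" using that(2,3) b(2) \<sigma>(3)[OF that(1)] by auto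
    qed
    have "pairing (is_basis P) ?C ?D' ?\<tau>"
    proof (rule pairingI)
      show "?\<tau> x \<in> ?D' \<and> ?\<tau> x \<noteq> x \<and> ?\<tau> (?\<tau> x) = x" if "x \<in> ?D'" for x
      proof -
        consider "x = e" | "x = \<sigma> f" | "x \<in> ?D" "x \<noteq> f" "x \<noteq> \<sigma> f" "x \<noteq> e"
          using \<open>x \<in> ?D'\<close> by blast
        then show ?thesis
        proof cases
          case 3
          with stay[OF 3(1-3)] \<sigma>[OF 3(1)] show ?thesis by simp
        qed (use b be in simp_all)
      qed
      fix T assume T: "T \<subseteq> ?D'" "\<And>x. x \<in> ?D' \<Longrightarrow> x \<in> T \<longleftrightarrow> ?\<tau> x \<notin> T"
      have eb: "e \<in> T \<longleftrightarrow> \<sigma> f \<notin> T" using T(2)[of e] be by simp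
      have fT: "f \<notin> T" using T(1) e by auto
      \<comment> \<open>Trading \<open>e\<close> back for \<open>f\<close> turns a transversal of
        the new pairs into one of the old pairs.\<close>
      define S where "S = (if e \<in> T then insert f (T - {e}) else T)"
      have b: "is_basis M (?C \<union> S)"
      proof (rule pairing_transversal[OF p])
        show "S \<subseteq> ?D" using T(1) unfolding S_def by auto
        fix x assume x: "x \<in> ?D"
        consider "x = f" | "x = \<sigma> f" | "x \<noteq> f" "x \<noteq> \<sigma> f" by blast
        then show "x \<in> S \<longleftrightarrow> \<sigma> x \<notin> S"
        proof cases
          case 3
          have "x \<noteq> e" using x D(1) by blast
          with stay[OF x 3] T(2)[of x] x 3 show ?thesis unfolding S_def by simp
        qed (use eb fT b be in \<open>simp_all add: S_def\<close>)
      qed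
      show "is_basis P (?C \<union> T)"
      proof (cases "e \<in> T")
        case True
        have "insert f (?C \<union> T - {e}) = ?C \<union> S" using C(2) True unfolding S_def by auto
        then show ?thesis using b True fT C I(2) by (intro basis_principal_extensionI[of f]) auto
      next
        case False
        then show ?thesis using b C(2)
          unfolding S_def by (subst basis_principal_extension_old) auto
      qed
    qed
    then show ?thesis unfolding C(1) eq(3) by blast
  qed
qed

lemma sbro_principal_extension: "sbro_matroid P"
proof (rule sbro_matroidI[OF matroid_principal_extension])
  have new: "\<exists>I f. X = insert e I \<and> e \<notin> I \<and> f \<in> F \<and> f \<notin> I \<and> is_basis M (insert f I)"
    if X: "is_basis P X" "e \<in> X" for X
  proof -
    have "X = insert e (X - {e})" using X by auto
    then show ?thesis
      using X basis_principal_extension_new[of "X - {e}"] by (metis Diff_iff singletonI)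
  qed
  fix A B assume A: "is_basis P A" and B: "is_basis P B"
  consider "e \<notin> A" "e \<notin> B" | "e \<in> A" "e \<notin> B" | "e \<notin> A" "e \<in> B" | "e \<in> A" "e \<in> B" by blast
  then show "\<exists>\<sigma>. pairing (is_basis P) (A \<inter> B) (sym_diff A B) \<sigma>"
  proof cases
    case 1
    then have "is_basis M A" "is_basis M B"
      using A B by (auto simp: basis_principal_extension_old)
    then obtain \<sigma> where "pairing (is_basis M) (A \<inter> B) (sym_diff A B) \<sigma>" by (rule basis_pairing)
    then have "pairing (is_basis P) (A \<inter> B) (sym_diff A B) \<sigma>"
    proof (rule pairing_mono)
      show "is_basis P X" if "X \<subseteq> A \<inter> B \<union> sym_diff A B" "is_basis M X" for X
        using that 1 by (subst basis_principal_extension_old) auto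
    qed
    then show ?thesis by blast
  next
    case 2
    then show ?thesis
      using new[OF A] B pairing_mixed_bases by (auto simp: basis_principal_extension_old)
  next
    case 3
    then have "\<exists>\<sigma>. pairing (is_basis P) (B \<inter> A) (sym_diff B A) \<sigma>"
      using new[OF B] A pairing_mixed_bases by (auto simp: basis_principal_extension_old)
    then show ?thesis by (simp add: Int_commute Un_commute)
  next
    case 4
    obtain I f where I: "A = insert e I" "e \<notin> I" "f \<in> F" "f \<notin> I" "is_basis M (insert f I)"
      using new[OF A] 4 by blast
    obtain J g where J: "B = insert e J" "e \<notin> J" "g \<in> F" "g \<notin> J" "is_basis M (insert g J)"
      using new[OF B] 4 by blast
    \<comment> \<open>Both bases contain \<open>e\<close>, but with possibly different stand-ins. In
      the result \<open>e\<close> stays in the intersection, and each transversal may use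
      \<open>f\<close> or \<open>g\<close>, both of which lie in \<open>F\<close>.\<close>
    let ?\<B> = "\<lambda>X. \<exists>z\<in>{f, g}. z \<notin> X \<and> is_basis M (insert z X)"
    obtain \<sigma> where "pairing (is_basis M) (insert f I \<inter> insert g J) (sym_diff (insert f I) (insert g J)) \<sigma>"
      using basis_pairing[OF I(5) J(5)] .
    from pairing_complete[OF I(4) J(4) this]
    obtain \<tau> where p: "pairing ?\<B> (I \<inter> J) (sym_diff I J) \<tau>" by blast
    have eq: "A \<inter> B = insert e (I \<inter> J)" "sym_diff A B = sym_diff I J" using I J by auto
    have "pairing (is_basis P) (insert e (I \<inter> J)) (sym_diff I J) \<tau>"
    proof (rule pairingI)
      fix T assume T: "T \<subseteq> sym_diff I J" "\<And>x. x \<in> sym_diff I J \<Longrightarrow> x \<in> T \<longleftrightarrow> \<tau> x \<notin> T"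
      have "?\<B> (I \<inter> J \<union> T)" using p T by (rule pairing_transversal)
      moreover have "e \<notin> I \<inter> J \<union> T" using T(1) I J by auto
      ultimately have "is_basis P (insert e (I \<inter> J \<union> T))"
        using I J by (subst basis_principal_extension_new) auto
      then show "is_basis P (insert e (I \<inter> J) \<union> T)" by simp
    qed (use pairing_involution[OF p] in simp)
    then show ?thesis unfolding eq by blast
  qed
qed

end

subsection \<open>Induction by bipartite graphs\<close>

text \<open>Invariance under isomorphism, with the pairing conjugated by \<open>f\<close>. The two
  element types differ because the bipartite construction lives on a sum type.\<close>

lemma sbro_transport:
  fixes M :: "'a pre_matroid" and N :: "'b pre_matroid"
  assumes "sbro_matroid M"
    and f: "bij_betw f (ground N) (ground M)"
    and ind: "\<And>X. X \<in> indeps N \<longleftrightarrow> X \<subseteq> ground N \<and> f ` X \<in> indeps M"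
  shows "sbro_matroid N"
proof -
  interpret M: sbro_matroid M by fact
  let ?E = "ground N"
  have inj: "inj_on f ?E" and img: "f ` ?E = ground M" using f by (auto simp: bij_betw_def)
  have fin: "finite ?E" using f M.finite_ground bij_betw_finite by blast
  have card: "card (f ` X) = card X" if "X \<subseteq> ?E" for X
    using inj that by (meson card_image inj_on_subset)
  have mat: "matroid N"
  proof
    show "{} \<in> indeps N" using M.empty_indep by (simp add: ind)
    show "Y \<in> indeps N" if "X \<in> indeps N" "Y \<subseteq> X" for X Y
      using that M.indep_subset[of "f ` X" "f ` Y"] by (auto simp: ind)
    show "\<exists>y\<in>Y - X. insert y X \<in> indeps N"
      if X: "X \<in> indeps N" and Y: "Y \<in> indeps N" and lt: "card X < card Y" for X Y
    proof -
      have "card (f ` X) < card (f ` Y)" using card X Y lt by (simp add: ind)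
      then obtain z where "z \<in> f ` Y - f ` X" "insert z (f ` X) \<in> indeps M"
        using M.augmentation[of "f ` X" "f ` Y"] X Y by (auto simp: ind)
      then obtain y where "y \<in> Y" "y \<notin> X" "f ` insert y X \<in> indeps M" by auto
      then show ?thesis using X Y by (auto simp: ind)
    qed
  qed (use fin ind in auto)
  have basis: "is_basis N X \<longleftrightarrow> X \<subseteq> ?E \<and> is_basis M (f ` X)" for X
  proof
    assume X: "is_basis N X"
    then have XE: "X \<subseteq> ?E" "f ` X \<in> indeps M" by (auto simp: is_basis_def ind)
    have "Z = f ` X" if Z: "Z \<in> indeps M" "f ` X \<subseteq> Z" for Z
    proof -
      obtain Y where Y: "Y \<subseteq> ?E" "Z = f ` Y"
        using Z(1) M.indeps_subset_ground img by (metis subset_imageE)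
      then have "X \<subseteq> Y" using Z(2) XE(1) inj_on_image_mem_iff[OF inj _ Y(1)] by blast
      moreover have "Y \<in> indeps N" using Y Z by (simp add: ind)
      ultimately show ?thesis using X Y by (auto simp: is_basis_def)
    qed
    with XE show "X \<subseteq> ?E \<and> is_basis M (f ` X)" by (simp add: is_basis_def)
  next
    assume X: "X \<subseteq> ?E \<and> is_basis M (f ` X)"
    have "Y = X" if Y: "Y \<in> indeps N" "X \<subseteq> Y" for Y
    proof -
      have "f ` Y = f ` X" using X Y by (simp add: is_basis_def ind image_mono)
      then show ?thesis using X Y inj_on_image_eq_iff[OF inj] by (simp add: ind)
    qed
    with X show "is_basis N X" by (simp add: is_basis_def ind)
  qed
  show ?thesis
  proof (rule sbro_matroidI[OF mat])
    fix A B assume "is_basis N A" "is_basis N B"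
    then have A: "A \<subseteq> ?E" "is_basis M (f ` A)" and B: "B \<subseteq> ?E" "is_basis M (f ` B)"
      by (auto simp: basis)
    let ?D = "sym_diff A B"
    have eq: "f ` A \<inter> f ` B = f ` (A \<inter> B)" "sym_diff (f ` A) (f ` B) = f ` ?D"
    proof -
      have "A - B \<subseteq> ?E" "B - A \<subseteq> ?E" using A B by auto
      then show "f ` A \<inter> f ` B = f ` (A \<inter> B)" "sym_diff (f ` A) (f ` B) = f ` ?D"
        using inj_on_image_Int[OF inj A(1) B(1)] inj_on_image_set_diff[OF inj _ A(1), of B]
          inj_on_image_set_diff[OF inj _ B(1), of A] by (simp_all add: image_Un)
    qed
    obtain \<sigma> where p: "pairing (is_basis M) (f ` (A \<inter> B)) (f ` ?D) \<sigma>"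
      using M.basis_pairing[OF A(2) B(2)] unfolding eq by blast
    note \<sigma> = pairing_involution[OF p]
    define g where "g = inv_into ?E f"
    define \<tau> where "\<tau> x = g (\<sigma> (f x))" for x
    have DE: "?D \<subseteq> ?E" using A B by blast
    have gf: "g (f x) = x" if "x \<in> ?D" for x
      using inv_into_f_f[OF inj, of x] that DE unfolding g_def by blast
    have \<tau>: "\<tau> x \<in> ?D" "f (\<tau> x) = \<sigma> (f x)" if x: "x \<in> ?D" for x
    proof -
      obtain y where "y \<in> ?D" "\<sigma> (f x) = f y" using \<sigma>(1)[of "f x"] x by blast
      then show "\<tau> x \<in> ?D" "f (\<tau> x) = \<sigma> (f x)" using gf[of y] by (auto simp: \<tau>_def)
    qed
    have "pairing (is_basis N) (A \<inter> B) ?D \<tau>"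
    proof (rule pairingI)
      fix x assume x: "x \<in> ?D"
      then have "f (\<tau> (\<tau> x)) = f x" using \<tau> \<sigma>(3)[of "f x"] by (metis imageI)
      then have "\<tau> (\<tau> x) = x" using gf[OF x] gf[OF \<tau>(1)[OF \<tau>(1)[OF x]]] by metis
      moreover have "\<tau> x \<noteq> x" using \<tau>(2)[OF x] \<sigma>(2)[of "f x"] x by auto
      ultimately show "\<tau> x \<in> ?D \<and> \<tau> x \<noteq> x \<and> \<tau> (\<tau> x) = x" using \<tau>(1)[OF x] by simp
    next
      fix T assume T: "T \<subseteq> ?D" "\<And>x. x \<in> ?D \<Longrightarrow> x \<in> T \<longleftrightarrow> \<tau> x \<notin> T"
      have mem: "f x \<in> f ` T \<longleftrightarrow> x \<in> T" if "x \<in> ?D" for x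
        using inj_on_image_mem_iff[OF inj, of x T] that DE T(1) by blast
      have "is_basis M (f ` (A \<inter> B) \<union> f ` T)"
      proof (rule pairing_transversal[OF p])
        show "y \<in> f ` T \<longleftrightarrow> \<sigma> y \<notin> f ` T" if y: "y \<in> f ` ?D" for y
        proof -
          obtain x where x: "x \<in> ?D" "y = f x" using y by blast
          then show ?thesis using mem[OF x(1)] mem[OF \<tau>(1)[OF x(1)]] T(2)[OF x(1)] \<tau>(2)[OF x(1)]
            by simp
        qed
      qed (use T in blast)
      then show "is_basis N (A \<inter> B \<union> T)" using A B T(1) by (auto simp: basis image_Un)
    qed
    then show "\<exists>\<sigma>. pairing (is_basis N) (A \<inter> B) ?D \<sigma>" by blast
  qed
qed

section \<open>Matchings onto independent sets\<close>

definition matchable :: "('b \<Rightarrow> 'a set) \<Rightarrow> 'a pre_matroid \<Rightarrow> 'b set \<Rightarrow> bool" where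
  "matchable G M X \<longleftrightarrow> (\<exists>h. inj_on h X \<and> (\<forall>x\<in>X. h x \<in> G x) \<and> h ` X \<in> indeps M)"

definition graph_induced :: "'b set \<Rightarrow> ('b \<Rightarrow> 'a set) \<Rightarrow> 'a pre_matroid \<Rightarrow> 'b pre_matroid" where
  "graph_induced S G M = \<lparr>ground = S, indeps = {X. X \<subseteq> S \<and> matchable G M X}\<rparr>"

lemma ground_graph_induced [simp]: "ground (graph_induced S G M) = S"
  by (simp add: graph_induced_def)

lemma indeps_graph_induced: "X \<in> indeps (graph_induced S G M) \<longleftrightarrow> X \<subseteq> S \<and> matchable G M X"
  by (simp add: graph_induced_def)

lemma matchable_reindex:
  assumes "inj_on \<iota> X" "\<And>x. x \<in> X \<Longrightarrow> K (\<iota> x) = G x"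
  shows "matchable K M (\<iota> ` X) \<longleftrightarrow> matchable G M X"
proof
  assume "matchable K M (\<iota> ` X)"
  then obtain h where h: "inj_on h (\<iota> ` X)" "\<forall>y\<in>\<iota> ` X. h y \<in> K y" "h ` \<iota> ` X \<in> indeps M"
    unfolding matchable_def by blast
  have "inj_on (h \<circ> \<iota>) X" using assms(1) h(1) by (rule comp_inj_on)
  then show "matchable G M X"
    unfolding matchable_def using h(2,3) assms(2)
    by (intro exI[of _ "h \<circ> \<iota>"]) (auto simp: image_comp)
next
  assume "matchable G M X"
  then obtain h where h: "inj_on h X" "\<forall>x\<in>X. h x \<in> G x" "h ` X \<in> indeps M"
    unfolding matchable_def by blast
  let ?k = "h \<circ> inv_into X \<iota>"
  have inv: "inv_into X \<iota> (\<iota> x) = x" if "x \<in> X" for x using assms(1) that by simp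
  have "inj_on ?k (\<iota> ` X)" using h(1) inv by (auto simp: inj_on_def)
  moreover have "?k ` \<iota> ` X = h ` X" using inv by (force simp: image_iff)
  ultimately show "matchable K M (\<iota> ` X)"
    unfolding matchable_def using h(2,3) assms(2) inv by (intro exI[of _ ?k]) auto
qed

text \<open>The new vertex \<open>y\<close> takes over the image of \<open>x\<close>. It is used
  both to replace a copy of a ground element by a vertex \<open>s\<close> and to go back.\<close>

lemma matchable_exchange:
  assumes h: "inj_on h (insert x I)" "\<forall>z\<in>I. h z \<in> K z" "h ` insert x I \<in> indeps M"
    and xy: "x \<notin> I" "y \<notin> I" "h x \<in> K y"
  shows "matchable K M (insert y I)"
proof -
  let ?h = "h(y := h x)"
  have "?h ` I = h ` I" using xy(2) by auto
  moreover have "h x \<notin> h ` I" using h(1) xy(1) by auto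
  ultimately have "inj_on ?h (insert y I)" "?h ` insert y I = h ` insert x I"
    using h(1) xy by (auto simp: inj_on_def)
  then show ?thesis
    unfolding matchable_def using h xy by (intro exI[of _ ?h]) auto
qed

text \<open>The left summand holds the copies of the ground elements, each adjacent only to its
  original; the matroid induced on these copies is isomorphic to the given one.\<close>

definition bipartite_neighbours :: "('b \<Rightarrow> 'a set) \<Rightarrow> 'a + 'b \<Rightarrow> 'a set" where
  "bipartite_neighbours G = case_sum (\<lambda>x. {x}) G"

lemma bipartite_neighbours_simps [simp]:
  "bipartite_neighbours G (Inl x) = {x}" "bipartite_neighbours G (Inr y) = G y"
  by (auto simp: bipartite_neighbours_def)

text \<open>
  Keeping a copy of the ground set next to \<open>S\<close> turns the addition of a vertex to \<open>S\<close> into a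
  principal extension.
\<close>
lemma graph_induced_insert:
  fixes M :: "'a pre_matroid" and G :: "'b \<Rightarrow> 'a set"
  assumes "matroid M" "s \<notin> S"
  defines "K \<equiv> bipartite_neighbours G"
  shows "graph_induced (Inl ` ground M \<union> Inr ` insert s S) K M =
    principal_extension (graph_induced (Inl ` ground M \<union> Inr ` S) K M) (Inl ` (G s \<inter> ground M)) (Inr s)"
    (is "graph_induced ?V' K M = principal_extension ?N ?F _")
proof -
  interpret matroid M by fact
  have "X \<in> indeps (graph_induced ?V' K M) \<longleftrightarrow> X \<in> indeps (principal_extension ?N ?F (Inr s))" for X
  proof (cases "Inr s \<in> X")
    case False
    then have "X \<in> indeps (principal_extension ?N ?F (Inr s)) \<longleftrightarrow> X \<in> indeps ?N"
      by (auto simp: principal_extension_def)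
    moreover have "X \<subseteq> ?V' \<longleftrightarrow> X \<subseteq> Inl ` ground M \<union> Inr ` S" using False by auto
    ultimately show ?thesis by (simp add: indeps_graph_induced)
  next
    case True
    define I where "I = X - {Inr s}"
    have X: "X = insert (Inr s) I" "Inr s \<notin> I" using True by (auto simp: I_def)
    have "X \<notin> indeps ?N" using True assms(2) by (auto simp: indeps_graph_induced)
    moreover have "X = insert (Inr s) J \<longleftrightarrow> J = I" if "insert f J \<in> indeps ?N" for f J
    proof -
      have "Inr s \<notin> J" using that assms(2) by (auto simp: indeps_graph_induced)
      then show ?thesis using X insert_ident by metis
    qed
    ultimately have "X \<in> indeps (principal_extension ?N ?F (Inr s)) \<longleftrightarrow>
        (\<exists>f\<in>?F. f \<notin> I \<and> insert f I \<in> indeps ?N)"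
      by (auto simp: principal_extension_def)
    also have "\<dots> \<longleftrightarrow> X \<in> indeps (graph_induced ?V' K M)"
    proof
      assume "\<exists>f\<in>?F. f \<notin> I \<and> insert f I \<in> indeps ?N"
      then obtain a where a: "a \<in> G s" "Inl a \<notin> I" "insert (Inl a) I \<subseteq> Inl ` ground M \<union> Inr ` S"
        "matchable K M (insert (Inl a) I)"
        by (auto simp: indeps_graph_induced)
      from a(4) obtain h where h: "inj_on h (insert (Inl a) I)" "\<forall>z\<in>insert (Inl a) I. h z \<in> K z"
        "h ` insert (Inl a) I \<in> indeps M"
        unfolding matchable_def by blast
      have "h (Inl a) \<in> K (Inr s)" using h(2) a(1) by (simp add: K_def)
      then have "matchable K M (insert (Inr s) I)"
        using h a(2) X(2) by (intro matchable_exchange[of h "Inl a"]) auto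
      then show "X \<in> indeps (graph_induced ?V' K M)"
        using a(3) unfolding X(1) indeps_graph_induced by auto
    next
      assume "X \<in> indeps (graph_induced ?V' K M)"
      then have sub: "insert (Inr s) I \<subseteq> ?V'" and "matchable K M (insert (Inr s) I)"
        unfolding X(1) indeps_graph_induced by auto
      then obtain h where h: "inj_on h (insert (Inr s) I)" "\<forall>z\<in>insert (Inr s) I. h z \<in> K z"
        "h ` insert (Inr s) I \<in> indeps M"
        unfolding matchable_def by blast
      let ?a = "h (Inr s)"
      have a: "?a \<in> G s" "?a \<in> ground M"
        using h(2) indeps_subset_ground[OF h(3)] by (auto simp: K_def)
      \<comment> \<open>A copy \<open>Inl ?a\<close> can only be matched to \<open>?a\<close>, which
        \<open>h\<close> already assigns to \<open>Inr s\<close>. It is therefore free to act as the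
        stand-in for \<open>Inr s\<close>.\<close>
      have "Inl ?a \<notin> I"
      proof
        assume *: "Inl ?a \<in> I"
        then have "h (Inl ?a) = ?a" using h(2) by (auto simp: K_def)
        then show False using h(1) * X(2) by (auto simp: inj_on_def)
      qed
      moreover from this have "matchable K M (insert (Inl ?a) I)"
        using h X(2) by (intro matchable_exchange[of h "Inr s"]) (auto simp: K_def)
      moreover have "insert (Inl ?a) I \<subseteq> Inl ` ground M \<union> Inr ` S"
        using sub a X(2) by auto
      ultimately show "\<exists>f\<in>?F. f \<notin> I \<and> insert f I \<in> indeps ?N"
        using a by (intro bexI[of _ "Inl ?a"]) (auto simp: indeps_graph_induced)
    qed
    finally show ?thesis ..
  qed
  then have "indeps (graph_induced ?V' K M) = indeps (principal_extension ?N ?F (Inr s))" by blast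
  moreover have "ground (graph_induced ?V' K M) = ground (principal_extension ?N ?F (Inr s))"
    by (auto simp: principal_extension_def)
  ultimately show ?thesis by (intro pre_matroid.equality) auto
qed

lemma sbro_graph_induced_copy:
  fixes M :: "'a pre_matroid" and G :: "'b \<Rightarrow> 'a set"
  assumes "sbro_matroid M" "finite S"
  shows "sbro_matroid (graph_induced (Inl ` ground M \<union> Inr ` S) (bipartite_neighbours G) M)"
  using assms(2)
proof (induction S rule: finite_induct)
  case empty
  interpret sbro_matroid M by fact
  let ?N = "graph_induced (Inl ` ground M \<union> Inr ` {}) (bipartite_neighbours G) M"
  show ?case
  proof (rule sbro_transport[OF assms(1), where f = projl])
    show "bij_betw projl (ground ?N) (ground M)"
      by (auto simp: bij_betw_def inj_on_def image_iff)
    fix X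
    show "X \<in> indeps ?N \<longleftrightarrow> X \<subseteq> ground ?N \<and> projl ` X \<in> indeps M"
    proof (cases "X \<subseteq> ground ?N")
      case True
      have "matchable (bipartite_neighbours G) M X \<longleftrightarrow> projl ` X \<in> indeps M"
      proof
        assume "matchable (bipartite_neighbours G) M X"
        then obtain h where h: "\<forall>x\<in>X. h x \<in> bipartite_neighbours G x" "h ` X \<in> indeps M"
          unfolding matchable_def by blast
        have "h x = projl x" if "x \<in> X" for x using True h(1) that by fastforce
        then have "h ` X = projl ` X" by (rule image_cong[OF refl])
        then show "projl ` X \<in> indeps M" using h(2) by simp
      next
        assume "projl ` X \<in> indeps M"
        moreover have "inj_on projl (Inl ` ground M)" by (auto simp: inj_on_def)
        then have "inj_on projl X" "\<forall>x\<in>X. projl x \<in> bipartite_neighbours G x"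
          using True by (auto intro: inj_on_subset)
        ultimately show "matchable (bipartite_neighbours G) M X"
          unfolding matchable_def by blast
      qed
      then show ?thesis using True by (simp add: indeps_graph_induced)
    qed (simp add: indeps_graph_induced)
  qed
next
  case (insert s S)
  let ?N = "graph_induced (Inl ` ground M \<union> Inr ` S) (bipartite_neighbours G) M"
  interpret N: principal_extension_sbro ?N "Inl ` (G s \<inter> ground M)" "Inr s"
    using insert by (auto intro!: principal_extension_sbro.intro principal_extension_matroid.intro
        principal_extension_matroid_axioms.intro simp: sbro_matroid.axioms(1))
  have "matroid M" using assms(1) by (rule sbro_matroid.axioms(1))
  from graph_induced_insert[OF this insert.hyps(2)] show ?case
    by (simp only: N.sbro_principal_extension)
qed

lemma sbro_graph_induced:
  fixes M :: "'a pre_matroid" and G :: "'b \<Rightarrow> 'a set"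
  assumes "sbro_matroid M" "finite S"
  shows "sbro_matroid (graph_induced S G M)"
proof (rule sbro_transport[where f = Inr])
  let ?N = "graph_induced (Inl ` ground M \<union> Inr ` S) (bipartite_neighbours G) M"
  let ?N' = "deletion ?N (Inl ` ground M)"
  show "sbro_matroid ?N'"
    using sbro_graph_induced_copy[OF assms] by (rule sbro_matroid.sbro_deletion)
  show "bij_betw Inr (ground (graph_induced S G M)) (ground ?N')"
    by (auto simp: bij_betw_def deletion_def)
  show "X \<in> indeps (graph_induced S G M) \<longleftrightarrow>
      X \<subseteq> ground (graph_induced S G M) \<and> Inr ` X \<in> indeps ?N'" for X
  proof -
    have "matchable (bipartite_neighbours G) M (Inr ` X) \<longleftrightarrow> matchable G M X"
      by (rule matchable_reindex) auto
    then show ?thesis by (auto simp: deletion_def indeps_graph_induced)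
  qed
qed

subsection \<open>Induction by directed graphs\<close>

text \<open>Every ground element may be matched to itself, so a basis of \<open>M\<close> is
  independent in the induced matroid and the two ranks agree. Bases on both sides can then be
  compared by size.\<close>

lemma basis_graph_induced_iff:
  assumes "matroid M" "matroid (graph_induced S G M)"
    and refl: "ground M \<subseteq> S" "\<And>x. x \<in> ground M \<Longrightarrow> x \<in> G x"
  shows "is_basis (graph_induced S G M) X \<longleftrightarrow>
    X \<subseteq> S \<and> (\<exists>h. inj_on h X \<and> (\<forall>x\<in>X. h x \<in> G x) \<and> is_basis M (h ` X))"
proof -
  interpret M: matroid M by fact
  interpret N: matroid "graph_induced S G M" by fact
  obtain B where B: "is_basis M B" by (rule M.basis_exists)
  have "matchable G M B"
    unfolding matchable_def using B refl M.basis_subset_ground[OF B]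
    by (intro exI[of _ id]) (auto simp: is_basis_def)
  then have "B \<in> indeps (graph_induced S G M)"
    using refl M.basis_subset_ground[OF B] by (auto simp: indeps_graph_induced)
  then obtain C where C: "is_basis (graph_induced S G M) C" "B \<subseteq> C"
    unfolding N.indep_iff_subset_basis by blast
  then obtain h where "inj_on h C" "h ` C \<in> indeps M"
    by (auto simp: is_basis_def indeps_graph_induced matchable_def)
  then have "card C \<le> card B" using M.basis_card_max[OF B] card_image by fastforce
  moreover have "finite C" using C N.indep_finite by (auto simp: is_basis_def)
  ultimately have "is_basis (graph_induced S G M) B" using C card_seteq by metis
  note iff = N.basis_iff_card[OF this] M.basis_iff_card[OF B]
  show ?thesis
    unfolding iff indeps_graph_induced matchable_def using card_image by fastforce
qed

section \<open>Linkages and matchings\<close>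

lemma vwalk_arcs_eq_zip: "vwalk_arcs p = zip p (tl p)"
  by (induction p rule: vwalk_arcs.induct) auto

lemma set_vwalk_arcs: "set (vwalk_arcs p) = {(p ! i, p ! Suc i) | i. Suc i < length p}"
  unfolding vwalk_arcs_eq_zip set_zip by (auto simp: nth_tl)

text \<open>Including \<open>v\<close> itself serves twice: vertices off the paths are matched to
  themselves, and \<open>basis_graph_induced_iff\<close> becomes applicable.\<close>

definition in_neighbours :: "'a pair_pre_digraph \<Rightarrow> 'a \<Rightarrow> 'a set" where
  "in_neighbours D v = insert v {u. (u, v) \<in> parcs D}"

text \<open>
  This and the next lemma are the linkage lemma: disjoint paths from \<open>X\<close> to \<open>I\<close> are the same as a
  matching of the complement of \<open>X\<close> onto the complement of \<open>I\<close> in which every vertex is matched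
  to itself or to an in-neighbour. On a path, vertices are matched to their predecessors.
\<close>
lemma linkage_imp_matching:
  assumes X: "X \<subseteq> pverts D"
    and path: "\<And>x. x \<in> X \<Longrightarrow> vpath (P x) (with_proj D)" "\<And>x. x \<in> X \<Longrightarrow> hd (P x) = x"
    and disj: "disjoint_family_on (\<lambda>x. set (P x)) X"
    and I: "I = (\<lambda>x. last (P x)) ` X"
  obtains h where "bij_betw h (pverts D - X) (pverts D - I)"
    "\<And>v. v \<in> pverts D - X \<Longrightarrow> h v \<in> in_neighbours D v"
proof -
  let ?V = "pverts D"
  \<comment> \<open>\<open>R u v\<close> says that \<open>u\<close> immediately precedes
    \<open>v\<close> on one of the paths, and \<open>W\<close> is the set of covered vertices.
    Distinctness and disjointness make \<open>R\<close> a bijective correspondence between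
    \<open>W - I\<close> and \<open>W - X\<close>: only last vertices lack a successor and only
    first ones a predecessor.\<close>
  define R where "R u v \<longleftrightarrow> (\<exists>x\<in>X. \<exists>i. Suc i < length (P x) \<and> u = P x ! i \<and> v = P x ! Suc i)" for u v
  define W where "W = (\<Union>x\<in>X. set (P x))"
  have ne: "P x \<noteq> []" and dist: "distinct (P x)" and sub: "set (P x) \<subseteq> ?V"
    and arcs: "set (vwalk_arcs (P x)) \<subseteq> parcs D" if "x \<in> X" for x
    using path(1)[OF that] by (auto simp: vpath_def vwalk_def)
  have nth: "x = y \<and> i = j"
    if "x \<in> X" "y \<in> X" "i < length (P x)" "j < length (P y)" "P x ! i = P y ! j" for x y i j
  proof -
    have "set (P x) \<inter> set (P y) \<noteq> {}" using that nth_mem by fastforce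
    then have "x = y" using disj that(1,2) by (auto simp: disjoint_family_on_def)
    then show ?thesis using that dist nth_eq_iff_index_eq by blast
  qed
  have start: "P x ! 0 = x" if "x \<in> X" for x using ne path(2) that by (simp add: hd_conv_nth)
  have R_W: "u \<in> W" "v \<in> W" if uv: "R u v" for u v
  proof -
    obtain x i where x: "x \<in> X" "Suc i < length (P x)" "u = P x ! i" "v = P x ! Suc i"
      using uv by (auto simp: R_def)
    then have "u \<in> set (P x)" "v \<in> set (P x)" by auto
    then show "u \<in> W" "v \<in> W" using x(1) unfolding W_def by auto
  qed
  have R_X: "v \<notin> X" if uv: "R u v" for u v
  proof
    assume v: "v \<in> X"
    obtain x i where x: "x \<in> X" "Suc i < length (P x)" "v = P x ! Suc i"
      using uv by (auto simp: R_def)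
    then have "P x ! Suc i = P v ! 0" using start[OF v] by metis
    then have "Suc i = 0" using nth[OF x(1) v x(2)] ne[OF v] by blast
    then show False by simp
  qed
  have R_I: "u \<notin> I" if uv: "R u v" for u v
  proof
    assume "u \<in> I"
    then obtain y where y: "y \<in> X" "u = P y ! (length (P y) - 1)"
      using ne by (auto simp: I last_conv_nth)
    obtain x i where x: "x \<in> X" "Suc i < length (P x)" "u = P x ! i"
      using uv by (auto simp: R_def)
    have "P x ! i = P y ! (length (P y) - 1)" using x(3) y(2) by (rule subst)
    then have "x = y \<and> i = length (P y) - 1"
      using x(2) ne[OF y(1)] by (intro nth[OF x(1) y(1)]) auto
    then show False using x(2) by auto
  qed
  have R_right: "v = v'" if uv: "R u v" "R u v'" for u v v'
  proof -
    obtain x i where x: "x \<in> X" "Suc i < length (P x)" "u = P x ! i" "v = P x ! Suc i"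
      using uv(1) by (auto simp: R_def)
    obtain y j where y: "y \<in> X" "Suc j < length (P y)" "u = P y ! j" "v' = P y ! Suc j"
      using uv(2) by (auto simp: R_def)
    have "x = y \<and> i = j" using x y by (intro nth) auto
    then show ?thesis using x y by simp
  qed
  have R_left: "u = u'" if uv: "R u v" "R u' v" for u u' v
  proof -
    obtain x i where x: "x \<in> X" "Suc i < length (P x)" "u = P x ! i" "v = P x ! Suc i"
      using uv(1) by (auto simp: R_def)
    obtain y j where y: "y \<in> X" "Suc j < length (P y)" "u' = P y ! j" "v = P y ! Suc j"
      using uv(2) by (auto simp: R_def)
    have "x = y \<and> Suc i = Suc j" using x y by (intro nth) auto
    then show ?thesis using x y by simp
  qed
  have pred: "\<exists>u. R u v" if v: "v \<in> W - X" for v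
  proof -
    obtain x i where x: "x \<in> X" "i < length (P x)" "v = P x ! i"
      using v by (auto simp: W_def in_set_conv_nth)
    then obtain j where "i = Suc j" using v start by (cases i) auto
    then show ?thesis using x by (auto simp: R_def)
  qed
  have succ: "\<exists>v. R u v" if u: "u \<in> W - I" for u
  proof -
    obtain x i where x: "x \<in> X" "i < length (P x)" "u = P x ! i"
      using u by (auto simp: W_def in_set_conv_nth)
    then have "i \<noteq> length (P x) - 1" using u ne by (auto simp: I last_conv_nth)
    then have "Suc i < length (P x)" using x(2) by linarith
    then show ?thesis using x by (auto simp: R_def)
  qed
  have WV: "W \<subseteq> ?V" using sub by (auto simp: W_def)
  have XW: "X \<subseteq> W" using path(2) ne hd_in_set unfolding W_def by fastforce
  have IW: "I \<subseteq> W" using ne by (auto simp: I W_def)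
  \<comment> \<open>The predecessor on the paths and the identity off them. On \<open>X\<close> the
    description has no witness, but \<open>h\<close> is only needed on the complement of
    \<open>X\<close>.\<close>
  define h where "h v = (if v \<in> W then THE u. R u v else v)" for v
  have hR: "h v = u" if "R u v" for u v
    using that R_left R_W(2)[OF that] unfolding h_def by (simp add: the_equality)
  have hW: "R (h v) v" if "v \<in> W - X" for v using pred[OF that] hR by metis
  have h_out: "h v = v" if "v \<notin> W" for v using that by (simp add: h_def)
  have "inj_on h (?V - X)"
  proof (rule inj_onI)
    fix v w assume vw: "v \<in> ?V - X" "w \<in> ?V - X" "h v = h w"
    show "v = w"
    proof (cases "v \<in> W")
      case True
      then have v: "R (h v) v" using vw hW by blast
      then have "w \<in> W" using R_W(1) h_out[of w] vw(3) by metis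
      then have "R (h w) w" using vw hW by blast
      then show ?thesis using v R_right vw(3) by metis
    next
      case False
      then have "w \<notin> W" using R_W(1)[OF hW, of w] h_out[of v] vw by auto
      then show ?thesis using False h_out vw(3) by metis
    qed
  qed
  moreover have "h ` (?V - X) = ?V - I"
  proof
    show "h ` (?V - X) \<subseteq> ?V - I"
    proof
      fix u assume "u \<in> h ` (?V - X)"
      then obtain v where v: "v \<in> ?V - X" "u = h v" by blast
      show "u \<in> ?V - I"
      proof (cases "v \<in> W")
        case True
        then have "R u v" using v hW by blast
        then show ?thesis using R_I R_W(1) WV by blast
      next
        case False
        then show ?thesis using v h_out IW by auto
      qed
    qed
    show "?V - I \<subseteq> h ` (?V - X)"
    proof
      fix u assume u: "u \<in> ?V - I"
      show "u \<in> h ` (?V - X)"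
      proof (cases "u \<in> W")
        case True
        then obtain v where "R u v" using succ u by blast
        then show ?thesis using hR R_X R_W(2) WV by (metis DiffI image_eqI subsetD)
      next
        case False
        then show ?thesis using u h_out XW by (metis DiffD1 DiffI image_eqI subsetD)
      qed
    qed
  qed
  ultimately have "bij_betw h (?V - X) (?V - I)" by (simp add: bij_betw_def)
  moreover have "h v \<in> in_neighbours D v" if "v \<in> ?V - X" for v
  proof (cases "v \<in> W")
    case True
    then have "R (h v) v" using that hW by blast
    then have "\<exists>x\<in>X. (h v, v) \<in> set (vwalk_arcs (P x))"
      unfolding R_def set_vwalk_arcs by blast
    then show ?thesis using arcs by (auto simp: in_neighbours_def)
  qed (simp add: h_out in_neighbours_def)
  ultimately show ?thesis by (rule that)
qed

lemma matching_imp_linkage: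
  assumes fin: "finite (pverts D)" and Z: "Z \<subseteq> pverts D" and Y: "Y \<subseteq> pverts D"
    and h: "bij_betw h Z (pverts D - Y)" "\<And>z. z \<in> Z \<Longrightarrow> h z \<in> in_neighbours D z"
  obtains P where "\<And>x. x \<in> pverts D - Z \<Longrightarrow> vpath (P x) (with_proj D) \<and> hd (P x) = x"
    "disjoint_family_on (\<lambda>x. set (P x)) (pverts D - Z)"
    "\<And>x. x \<in> pverts D - Z \<Longrightarrow> last (P x) \<in> Y"
proof -
  let ?V = "pverts D"
  \<comment> \<open>The inverse of the matching: \<open>s u\<close> is the vertex matched to
    \<open>u\<close>, so \<open>(u, s u)\<close> is an arc unless \<open>s u = u\<close>. The paths
    follow \<open>s\<close> until they reach \<open>Y\<close>.\<close>
  define s where "s = inv_into Z h"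
  have s: "s u \<in> Z" "h (s u) = u" if "u \<in> ?V - Y" for u
    using that h(1) inv_into_into[of u h Z] f_inv_into_f[of u h Z]
    unfolding s_def bij_betw_def by auto
  \<comment> \<open>Steps of \<open>s\<close> can be cancelled on both sides, since \<open>s\<close>
    is injective outside \<open>Y\<close>. Neither side can run out early, because values of
    \<open>s\<close> lie in \<open>Z\<close> and the starting points do not. This one fact yields
    termination, distinct vertices and disjoint paths.\<close>
  have orbit: "i = j \<and> x = y"
    if "x \<in> ?V - Z" "y \<in> ?V - Z" "\<forall>m<i. (s ^^ m) x \<in> ?V - Y" "\<forall>m<j. (s ^^ m) y \<in> ?V - Y"
      "(s ^^ i) x = (s ^^ j) y" for x y i j
    using that
  proof (induction i arbitrary: j)
    case 0
    show ?case
    proof (cases j)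
      case (Suc k)
      then have "x = s ((s ^^ k) y)" "(s ^^ k) y \<in> ?V - Y" using 0 by auto
      then have "x \<in> Z" using s(1) by metis
      then show ?thesis using 0 by simp
    qed (use 0 in simp)
  next
    case (Suc i)
    have xi: "(s ^^ i) x \<in> ?V - Y" using Suc.prems(3) by blast
    show ?case
    proof (cases j)
      case 0
      then have "y = s ((s ^^ i) x)" using Suc.prems by simp
      then have "y \<in> Z" using s(1)[OF xi] by simp
      then show ?thesis using Suc.prems by simp
    next
      case (Suc k)
      then have yk: "(s ^^ k) y \<in> ?V - Y" using Suc.prems(4) by blast
      have "s ((s ^^ i) x) = s ((s ^^ k) y)" using Suc Suc.prems(5) by simp
      then have "(s ^^ i) x = (s ^^ k) y" using s(2)[OF xi] s(2)[OF yk] by metis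
      then have "i = k \<and> x = y" using Suc.prems Suc by (intro Suc.IH) auto
      then show ?thesis using Suc by simp
    qed
  qed
  have stays: "(s ^^ i) x \<in> ?V" if "x \<in> ?V" "\<forall>m<i. (s ^^ m) x \<notin> Y" for x i
    using that
  proof (induction i)
    case (Suc i)
    then have "(s ^^ i) x \<in> ?V - Y" by auto
    then show ?case using s(1) Z by auto
  qed simp
  \<comment> \<open>An orbit that never met \<open>Y\<close> would consist of infinitely many
    distinct vertices.\<close>
  have reach: "\<exists>k. (s ^^ k) x \<in> Y" if x: "x \<in> ?V - Z" for x
  proof (rule ccontr)
    assume "\<not> ?thesis"
    then have all: "(s ^^ k) x \<in> ?V - Y" for k using stays x by auto
    then have "inj (\<lambda>k. (s ^^ k) x)" using orbit[OF x x] by (intro injI) blast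
    moreover have "finite (range (\<lambda>k. (s ^^ k) x))"
      using all fin by (auto intro: finite_subset[of _ ?V])
    ultimately show False using finite_imageD by blast
  qed
  define k where "k x = (LEAST k. (s ^^ k) x \<in> Y)" for x
  have k: "(s ^^ k x) x \<in> Y" "\<forall>m<k x. (s ^^ m) x \<notin> Y" if "x \<in> ?V - Z" for x
    using reach[OF that] unfolding k_def by (auto intro: LeastI_ex dest: not_less_Least)
  have inner: "(s ^^ m) x \<in> ?V - Y" if "x \<in> ?V - Z" "m < k x" for x m
    using that k(2)[OF that(1)] stays[of x m] by auto
  \<comment> \<open>The list includes the first hit of \<open>Y\<close>, hence
    \<open>Suc (k x)\<close> vertices; a start in \<open>Y\<close> gives the one-vertex
    path.\<close>
  define P where "P x = map (\<lambda>i. (s ^^ i) x) [0..<Suc (k x)]" for x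
  have len: "length (P x) = Suc (k x)" for x by (simp add: P_def)
  have nth: "P x ! i = (s ^^ i) x" if "i \<le> k x" for x i
    using that unfolding P_def by (subst nth_map) (auto simp del: upt_Suc)
  have set: "set (P x) = {(s ^^ i) x | i. i \<le> k x}" for x
    unfolding P_def by (auto simp del: upt_Suc)
  have ne: "P x \<noteq> []" for x using len[of x] by auto
  have "vpath (P x) (with_proj D) \<and> hd (P x) = x" if x: "x \<in> ?V - Z" for x
  proof -
    have "set (P x) \<subseteq> ?V"
      using k[OF x] inner[OF x] Y unfolding set by (auto simp: le_less)
    moreover have "set (vwalk_arcs (P x)) \<subseteq> parcs D"
    proof -
      have "((s ^^ i) x, s ((s ^^ i) x)) \<in> parcs D" if i: "i < k x" for i
      proof -
        let ?u = "(s ^^ i) x"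
        have u: "?u \<in> ?V - Y" using inner x i by blast
        \<comment> \<open>This rules out that a vertex is matched to itself, so the step is a
          genuine arc.\<close>
        have "?u \<noteq> s ?u"
        proof
          assume "?u = s ?u"
          then have "(s ^^ i) x = (s ^^ Suc i) x" by simp
          then show False using orbit[OF x x, of i "Suc i"] inner[OF x] i by auto
        qed
        then show ?thesis using h(2)[OF s(1)[OF u]] s(2)[OF u] by (simp add: in_neighbours_def)
      qed
      then show ?thesis unfolding set_vwalk_arcs len by (auto simp: nth)
    qed
    moreover have "distinct (P x)"
      unfolding distinct_conv_nth len
    proof (intro allI impI)
      fix i j assume "i < Suc (k x)" "j < Suc (k x)" "i \<noteq> j"
      then show "P x ! i \<noteq> P x ! j" using orbit[OF x x, of i j] inner[OF x] by (auto simp: nth)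
    qed
    moreover have "hd (P x) = x" using nth[of 0 x] ne[of x] by (simp add: hd_conv_nth)
    ultimately show ?thesis using ne by (auto simp: vpath_def vwalk_def)
  qed
  moreover have "disjoint_family_on (\<lambda>x. set (P x)) (?V - Z)"
    unfolding disjoint_family_on_def
  proof (intro ballI impI)
    fix x y assume x: "x \<in> ?V - Z" and y: "y \<in> ?V - Z" and "x \<noteq> y"
    have "(s ^^ i) x \<noteq> (s ^^ j) y" if "i \<le> k x" "j \<le> k y" for i j
      using orbit[OF x y, of i j] inner[OF x] inner[OF y] that \<open>x \<noteq> y\<close> by auto
    then show "set (P x) \<inter> set (P y) = {}" unfolding set by auto
  qed
  moreover have "last (P x) \<in> Y" if "x \<in> ?V - Z" for x
    using k(1)[OF that] nth[of "k x" x] ne[of x] by (simp add: last_conv_nth len)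
  ultimately show ?thesis by (rule that)
qed

text \<open>In \<open>N'\<close> the vertices outside \<open>ground N\<close> are added as loops, so
  that dualising takes complements within all of \<open>pverts D\<close>. A basis \<open>Z\<close>
  of the induced matroid \<open>?Q\<close> is matched onto the complement of a basis
  \<open>Y\<close> of \<open>N\<close>, which by the linkage lemma corresponds to disjoint paths
  from the complement of \<open>Z\<close> into \<open>Y\<close>.\<close>

lemma induced_matroid_eq_dual:
  assumes "matroid N" and D: "finite (pverts D)" "ground N \<subseteq> pverts D"
  defines "N' \<equiv> \<lparr>ground = pverts D, indeps = indeps N\<rparr>"
  assumes Q: "matroid (graph_induced (pverts D) (in_neighbours D) (dual_matroid N'))"
    and N': "matroid N'"
  shows "induced_matroid D N =
    dual_matroid (graph_induced (pverts D) (in_neighbours D) (dual_matroid N'))"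
    (is "_ = dual_matroid ?Q")
proof -
  let ?V = "pverts D"
  interpret N: matroid N by fact
  interpret N': matroid N' by fact
  have bN': "is_basis N' = is_basis N" by (rule is_basis_cong) (simp add: N'_def)
  have bQ: "is_basis ?Q Z \<longleftrightarrow> Z \<subseteq> ?V \<and> (\<exists>h. inj_on h Z \<and> (\<forall>z\<in>Z. h z \<in> in_neighbours D z) \<and>
      h ` Z \<subseteq> ?V \<and> is_basis N (?V - h ` Z))" for Z
    using basis_graph_induced_iff[OF N'.matroid_dual Q, of Z]
    by (simp add: N'.basis_dual_iff bN') (simp add: N'_def dual_matroid_def in_neighbours_def)
  have "X \<subseteq> ?V \<and> linked_to_indep D N X \<longleftrightarrow> (\<exists>Z. is_basis ?Q Z \<and> X \<subseteq> ?V - Z)" for X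
  proof
    assume X: "X \<subseteq> ?V \<and> linked_to_indep D N X"
    then obtain P where P: "\<And>x. x \<in> X \<Longrightarrow> vpath (P x) (with_proj D)" "\<And>x. x \<in> X \<Longrightarrow> hd (P x) = x"
      "disjoint_family_on (\<lambda>x. set (P x)) X" "(\<lambda>x. last (P x)) ` X \<in> indeps N"
      unfolding linked_to_indep_def by blast
    let ?I = "(\<lambda>x. last (P x)) ` X"
    obtain h where h: "bij_betw h (?V - X) (?V - ?I)" "\<And>v. v \<in> ?V - X \<Longrightarrow> h v \<in> in_neighbours D v"
      using linkage_imp_matching[OF _ P(1-3) refl] X by metis
    obtain Y where Y: "is_basis N Y" "?I \<subseteq> Y" using P(4) N.indep_iff_subset_basis by blast
    have YV: "Y \<subseteq> ?V" using N.basis_subset_ground[OF Y(1)] D by blast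
    \<comment> \<open>The ends \<open>?I\<close> of the paths need not form a basis. Once they are
      extended to \<open>Y\<close>, the part of the matching with values outside \<open>Y\<close> is
      kept; since the matching covers \<open>?V - ?I\<close>, this part still covers
      \<open>?V - Y\<close>.\<close>
    define Z where "Z = {v \<in> ?V - X. h v \<notin> Y}"
    have img: "h ` (?V - X) = ?V - ?I" using h(1) by (simp add: bij_betw_def)
    have "h ` Z = h ` (?V - X) - Y" unfolding Z_def by auto
    then have "h ` Z = ?V - Y" unfolding img using Y(2) by auto
    then have "?V - h ` Z = Y" "h ` Z \<subseteq> ?V" using YV by auto
    moreover have "inj_on h Z"
      using h(1) unfolding bij_betw_def Z_def by (auto intro: inj_on_subset)
    ultimately have "is_basis ?Q Z"
      unfolding bQ using Y h(2) by (auto simp: Z_def)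
    moreover have "X \<subseteq> ?V - Z" using X by (auto simp: Z_def)
    ultimately show "\<exists>Z. is_basis ?Q Z \<and> X \<subseteq> ?V - Z" by blast
  next
    assume "\<exists>Z. is_basis ?Q Z \<and> X \<subseteq> ?V - Z"
    then obtain Z where bZ: "is_basis ?Q Z" and XZ: "X \<subseteq> ?V - Z" by blast
    from bZ[unfolded bQ] obtain h where Z: "Z \<subseteq> ?V" "X \<subseteq> ?V - Z" and h: "inj_on h Z"
      "\<And>z. z \<in> Z \<Longrightarrow> h z \<in> in_neighbours D z" "h ` Z \<subseteq> ?V" "is_basis N (?V - h ` Z)"
      using XZ by auto
    let ?Y = "?V - h ` Z"
    have "bij_betw h Z (?V - ?Y)" using h by (auto simp: bij_betw_def)
    then obtain P where P: "\<And>x. x \<in> ?V - Z \<Longrightarrow> vpath (P x) (with_proj D) \<and> hd (P x) = x"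
      "disjoint_family_on (\<lambda>x. set (P x)) (?V - Z)" "\<And>x. x \<in> ?V - Z \<Longrightarrow> last (P x) \<in> ?Y"
      using matching_imp_linkage[OF D(1) Z(1) _ _ h(2), of ?Y] by blast
    have "(\<lambda>x. last (P x)) ` X \<subseteq> ?Y"
      by (rule image_subsetI, rule P(3), rule subsetD[OF Z(2)])
    then have "(\<lambda>x. last (P x)) ` X \<in> indeps N"
      using h(4) N.indep_subset[of ?Y] by (simp add: is_basis_def)
    moreover have "disjoint_family_on (\<lambda>x. set (P x)) X"
      using Z(2) P(2) by (rule disjoint_family_on_mono)
    ultimately have "linked_to_indep D N X"
      unfolding linked_to_indep_def using P(1)[OF subsetD[OF Z(2)]] by (intro exI[of _ P]) simp
    then show "X \<subseteq> ?V \<and> linked_to_indep D N X" using Z(2) by blast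
  qed
  then show ?thesis by (simp add: induced_matroid_def dual_matroid_def[of ?Q])
qed

lemma (in sbro_matroid) sbro_induced_matroid:
  assumes "pair_fin_digraph D" "ground M \<subseteq> pverts D"
  shows "sbro_matroid (induced_matroid D M)"
proof -
  let ?N = "\<lparr>ground = pverts D, indeps = indeps M\<rparr>"
  have fin: "finite (pverts D)" using assms(1) by (rule pair_fin_digraph.pair_finite_verts)
  have b: "is_basis ?N = is_basis M" by (rule is_basis_cong) simp
  have "matroid ?N"
  proof
    show "X \<subseteq> ground ?N" if "X \<in> indeps ?N" for X
      using that assms(2) indeps_subset_ground[of X] by auto
    show "Y \<in> indeps ?N" if "X \<in> indeps ?N" "Y \<subseteq> X" for X Y
      using that indep_subset[of X Y] by simp
    show "\<exists>y\<in>Y - X. insert y X \<in> indeps ?N"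
      if "X \<in> indeps ?N" "Y \<in> indeps ?N" "card X < card Y" for X Y
      using that augmentation[of X Y] by simp
  qed (use fin empty_indep in auto)
  then interpret N: sbro_matroid ?N
  proof (rule sbro_matroidI)
    show "\<exists>\<sigma>. pairing (is_basis ?N) (A \<inter> B) (sym_diff A B) \<sigma>"
      if "is_basis ?N A" "is_basis ?N B" for A B
      using that basis_pairing unfolding b by blast
  qed
  have Q: "sbro_matroid (graph_induced (pverts D) (in_neighbours D) (dual_matroid ?N))"
    by (rule sbro_graph_induced[OF N.sbro_dual fin])
  have "induced_matroid D M =
      dual_matroid (graph_induced (pverts D) (in_neighbours D) (dual_matroid ?N))"
    using induced_matroid_eq_dual[OF matroid_axioms fin assms(2) sbro_matroid.axioms(1)[OF Q]
      N.matroid_axioms] .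
  then show ?thesis using sbro_matroid.sbro_dual[OF Q] by simp
qed

theorem theorem4:
  shows "complete_class {M :: 'a pre_matroid. matroid M \<and> strongly_base_reorderable M}"
proof -
  have eq: "matroid M \<and> strongly_base_reorderable M \<longleftrightarrow> sbro_matroid M" for M :: "'a pre_matroid"
    by (simp add: sbro_matroid_def sbro_matroid_axioms_def)
  show ?thesis
    unfolding complete_class_def eq
    by (auto intro: sbro_matroid.axioms(1) sbro_matroid.sbro_minor sbro_matroid.sbro_dual
        sbro_direct_sum sbro_matroid.sbro_truncation sbro_matroid.sbro_induced_matroid)
qed

end
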